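(* Let $\Omega\subset\mathbb{O}$ be a domain and let $f:\Omega\to\mathbb{O}$ be a slice Fueter-regular function. Then for any $x,x'\in\Omega$ with $x\overset{\Omega}{\simeq}x'$, the stem vectors of $f$ at $x$ and $x'$ are identical, i.e. $(u_x,v_x)=(u_{x'},v_{x'})$.
   Context: Octonions. $\mathbb{O}$ is the real (non-associative) division algebra with basis $e_0=1,e_1,\dots,e_7$, with $e_l e_l=-1$ for $l\ge 1$ and $e_le_m=\sum_n\epsilon_{lmn}e_n$ for $l\ne m$ in $\{1,\dots,7\}$, where $\epsilon_{lmn}$ is completely antisymmetric, equal to $1$ on $(1,2,3),(1,4,5),(1,7,6),(2,4,6),(2,5,7),(3,4,7),(3,6,5)$, and $0$ on triples that are not permutations of these. For $x=\sum_{l=0}^7x_le_l$: $\Re(x)=x_0$, $\Im(x)=\sum_{l=1}^7x_le_l$, $|x|=(\sum x_l^2)^{1/2}$. $\mathbb{O}=\mathbb{R}^8$ carries the Euclidean topology; a domain is a nonempty connected open set. $\mathbb{S}=\{I\in\mathbb{O}:\Re(I)=0,|I|=1\}$. For $I\in\mathbb{S}$, $\tau_I(\alpha+\beta i)=\alpha+\beta I$ ($\alpha,\beta\in\mathbb{R}$). Slice functions and stem vectors. For $a\in\mathbb{R}$, $b>0$ let $\mathbb{S}(\Omega,a,b)=\{I\in\mathbb{S}: a+bI\in\Omega\}$. A function $f:\Omega\to\mathbb{O}$ is a slice function if for every connected component $\Lambda$ of any nonempty $\mathbb{S}(\Omega,a,b)$ there is $(u,v)\in\mathbb{O}^2$ with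 $f(a+bI)=u+Iv$ for all $I\in\Lambda$; this pair is unique. For $x=a+bI\in\Omega\setminus\mathbb{R}$ with $b>0$, $I\in\mathbb{S}$, the stem vector $(u_x,v_x)$ of $f$ at $x$ is the pair $(u,v)$ for the component $\Lambda\ni I$; for $x\in\Omega\cap\mathbb{R}$ it is $(f(x),0)$. Slice Fueter-regularity. Let $L_{mn}=x_m\frac{\partial}{\partial x_n}-x_n\frac{\partial}{\partial x_m}$ ($1\le m<n\le 7$), $\Gamma f=-\sum_{1\le m<n\le 7}e_m(e_n(L_{mn}f))$, $E=\sum_{l=1}^7x_l\frac{\partial}{\partial x_l}$, and $\overline{\partial}_Ff(x)=\frac{\partial f}{\partial x_0}(x)-\Im(x)^{-1}Ef(x)-\frac13\Im(x)^{-1}\Gamma f(x)$ for $x\in\Omega\setminus\mathbb{R}$. A slice function $f:\Omega\to\mathbb{O}$ of class $\mathcal{C}^1$ (in the real variables $x_0,\dots,x_7$) is slice Fueter-regular if $\overline{\partial}_Ff\equiv0$ on $\Omega\setminus\mathbb{R}$. CCL equivalence. A path in a space $X$ is a continuous map $[0,1]\to X$. For paths $\gamma$ in $\mathbb{C}$ and $\Theta$ in $\mathbb{S}$, the circular lifting of $\gamma$ via $\Theta$ is the path $\gamma_\Theta(t)=\tau_{\Theta(t)}(\gamma(t))$ in $\mathbb{O}$; $\gamma$ is its base and $\Theta$ its spherical coordinate. Two circular liftings $\gamma_{\Theta_1},\gamma_{\Theta_2}$ are coupled if they have a common base $\gamma$ and $\Theta_1(0)=\Theta_2(0)$. Points $x_1,x_2\in\Omega$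 are CCL-connected, $x_1\overset{\Omega}{\sim}x_2$, if there are coupled circular liftings $\gamma_{\Theta_1},\gamma_{\Theta_2}$ with $\gamma_{\Theta_k}([0,1])\subset\Omega$ and $\gamma_{\Theta_k}(1)=x_k$ ($k=1,2$). Points $x,x'\in\Omega$ are CCL-equivalent, $x\overset{\Omega}{\simeq}x'$, if there is a finite sequence $x=x_0,x_1,\dots,x_n=x'$ in $\Omega$ with $x_{k-1}\overset{\Omega}{\sim}x_k$ for $k=1,\dots,n$. *)

theory Defs
  imports "HOL-Analysis.Analysis"
begin

text \<open>Octonions are coordinate vectors indexed by the type \<open>8\<close>, whose elements are
  \<open>0, \<dots>, 7\<close>; this supplies the Euclidean norm and topology. The library multiplication
  on \<open>real ^ 8\<close> is componentwise, so the octonion product is a separate operation.\<close>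

type_synonym octonion = "real ^ 8"

abbreviation oe :: "8 \<Rightarrow> octonion" where
  "oe l \<equiv> axis l 1"

definition oct_triples :: "(8 \<times> 8 \<times> 8) set" where
  "oct_triples = {(1,2,3), (1,4,5), (1,7,6), (2,4,6), (2,5,7), (3,4,7), (3,6,5)}"

text \<open>The first condition lists the even permutations of \<open>(l, m, n)\<close>, the second one the
  odd permutations.\<close>

definition oct_eps :: "8 \<Rightarrow> 8 \<Rightarrow> 8 \<Rightarrow> real" where
  "oct_eps l m n =
    (if (l,m,n) \<in> oct_triples \<or> (m,n,l) \<in> oct_triples \<or> (n,l,m) \<in> oct_triples then 1
     else if (m,l,n) \<in> oct_triples \<or> (l,n,m) \<in> oct_triples \<or> (n,m,l) \<in> oct_triples then - 1
     else 0)"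

definition oct_basis_mult :: "8 \<Rightarrow> 8 \<Rightarrow> octonion" where
  "oct_basis_mult l m =
    (if l = 0 then oe m else if m = 0 then oe l else if l = m then - oe 0
     else (\<Sum>n\<in>UNIV - {0}. oct_eps l m n *\<^sub>R oe n))"

definition omult :: "octonion \<Rightarrow> octonion \<Rightarrow> octonion" (infix \<open>\<odot>\<close> 70) where
  "x \<odot> y = (\<Sum>l\<in>UNIV. \<Sum>m\<in>UNIV. (x $ l * y $ m) *\<^sub>R oct_basis_mult l m)"

definition ore :: "octonion \<Rightarrow> real" where
  "ore x = x $ 0"

definition oim :: "octonion \<Rightarrow> octonion" where
  "oim x = (\<Sum>l\<in>UNIV - {0}. x $ l *\<^sub>R oe l)"

definition ocnj :: "octonion \<Rightarrow> octonion" where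
  "ocnj x = ore x *\<^sub>R oe 0 - oim x"

definition oinv :: "octonion \<Rightarrow> octonion" where
  "oinv x = ocnj x /\<^sub>R (norm x)\<^sup>2"

lemma UNIV_8: "(UNIV :: 8 set) = {0,1,2,3,4,5,6,7}"
proof -
  have "card {0,1,2,3,4,5,6,7::8} = CARD(8)" by simp
  then show ?thesis using card_subset_eq[OF finite subset_UNIV] by blast
qed

lemma UNIV_8_nonzero: "UNIV - {0::8} = {1,2,3,4,5,6,7}"
proof -
  have "0 \<notin> {1,2,3,4,5,6,7::8}" by simp
  then show ?thesis unfolding UNIV_8 by blast
qed

lemma forall_8: "(\<forall>i::8. P i) \<longleftrightarrow> P 0 \<and> P 1 \<and> P 2 \<and> P 3 \<and> P 4 \<and> P 5 \<and> P 6 \<and> P 7"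
  using UNIV_8 by (metis UNIV_I insert_iff empty_iff)

lemma sum_8: "sum f (UNIV::8 set) = f 0 + f 1 + f 2 + f 3 + f 4 + f 5 + f 6 + f 7"
  unfolding UNIV_8 by (simp add: add.assoc)

lemma sum_8_nonzero: "sum f (UNIV-{0}::8 set) = f 1 + f 2 + f 3 + f 4 + f 5 + f 6 + f 7"
  unfolding UNIV_8_nonzero by (simp add: add.assoc)

text \<open>The order on the index type is the usual one on \<open>0, \<dots>, 7\<close>.\<close>

lemma less_8:
  "(0::8) < 1" "(1::8) < 2" "(2::8) < 3" "(3::8) < 4" "(4::8) < 5" "(5::8) < 6" "(6::8) < 7"
  by (simp_all add: less_bit0_def bit0.Rep_numeral bit0.Rep_0 bit0.Rep_1)

lemma atLeastAtMost_8: "{1..7::8} = UNIV - {0}"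
proof -
  have "\<forall>i::8. i \<in> {1..7} \<longleftrightarrow> i \<noteq> 0"
    unfolding forall_8
    by (simp add: less_eq_bit0_def bit0.Rep_numeral bit0.Rep_0 bit0.Rep_1)
  then show ?thesis by blast
qed

lemma oe_nth: "oe k $ n = (if n = k then 1 else 0)"
  by (simp add: axis_def)

lemma sum_oe_nth: "(\<Sum>k\<in>UNIV - {0}. c k *\<^sub>R oe k) $ n = (if n = 0 then 0 else c n)"
proof -
  have "(\<Sum>k\<in>UNIV - {0}. c k *\<^sub>R oe k) $ n = (\<Sum>k\<in>UNIV - {0}. if n = k then c k else 0)"
    unfolding sum_component by (rule sum.cong) (simp_all add: axis_def)
  then show ?thesis by (simp add: sum.delta)
qed

lemma oct_basis_mult_nth:
  "oct_basis_mult l m $ n =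
    (if l = 0 then if n = m then 1 else 0 else if m = 0 then if n = l then 1 else 0
     else if l = m then if n = 0 then - 1 else 0
     else if n = 0 then 0 else oct_eps l m n)"
  unfolding oct_basis_mult_def by (simp add: sum_oe_nth oe_nth del: sum_component)

lemma omult_nth_sum: "(x \<odot> y) $ n = (\<Sum>l\<in>UNIV. \<Sum>m\<in>UNIV. x $ l * y $ m * oct_basis_mult l m $ n)"
  by (simp add: omult_def)

lemma distinct_8:
  "(0::8) \<noteq> 1" "(0::8) \<noteq> 2" "(0::8) \<noteq> 3" "(0::8) \<noteq> 4" "(0::8) \<noteq> 5" "(0::8) \<noteq> 6" "(0::8) \<noteq> 7"
  "(1::8) \<noteq> 0" "(1::8) \<noteq> 2" "(1::8) \<noteq> 3" "(1::8) \<noteq> 4" "(1::8) \<noteq> 5" "(1::8) \<noteq> 6" "(1::8) \<noteq> 7"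
  "(2::8) \<noteq> 0" "(2::8) \<noteq> 1" "(2::8) \<noteq> 3" "(2::8) \<noteq> 4" "(2::8) \<noteq> 5" "(2::8) \<noteq> 6" "(2::8) \<noteq> 7"
  "(3::8) \<noteq> 0" "(3::8) \<noteq> 1" "(3::8) \<noteq> 2" "(3::8) \<noteq> 4" "(3::8) \<noteq> 5" "(3::8) \<noteq> 6" "(3::8) \<noteq> 7"
  "(4::8) \<noteq> 0" "(4::8) \<noteq> 1" "(4::8) \<noteq> 2" "(4::8) \<noteq> 3" "(4::8) \<noteq> 5" "(4::8) \<noteq> 6" "(4::8) \<noteq> 7"
  "(5::8) \<noteq> 0" "(5::8) \<noteq> 1" "(5::8) \<noteq> 2" "(5::8) \<noteq> 3" "(5::8) \<noteq> 4" "(5::8) \<noteq> 6" "(5::8) \<noteq> 7"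
  "(6::8) \<noteq> 0" "(6::8) \<noteq> 1" "(6::8) \<noteq> 2" "(6::8) \<noteq> 3" "(6::8) \<noteq> 4" "(6::8) \<noteq> 5" "(6::8) \<noteq> 7"
  "(7::8) \<noteq> 0" "(7::8) \<noteq> 1" "(7::8) \<noteq> 2" "(7::8) \<noteq> 3" "(7::8) \<noteq> 4" "(7::8) \<noteq> 5" "(7::8) \<noteq> 6"
  by simp_all

lemma omult_nth:
  "(a \<odot> b) $ 0 = a$0*b$0 - a$1*b$1 - a$2*b$2 - a$3*b$3 - a$4*b$4 - a$5*b$5 - a$6*b$6 - a$7*b$7"
  "(a \<odot> b) $ 1 = a$0*b$1 + a$1*b$0 + a$2*b$3 - a$3*b$2 + a$4*b$5 - a$5*b$4 + a$7*b$6 - a$6*b$7"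
  "(a \<odot> b) $ 2 = a$0*b$2 + a$2*b$0 + a$3*b$1 - a$1*b$3 + a$4*b$6 - a$6*b$4 + a$5*b$7 - a$7*b$5"
  "(a \<odot> b) $ 3 = a$0*b$3 + a$3*b$0 + a$1*b$2 - a$2*b$1 + a$4*b$7 - a$7*b$4 + a$6*b$5 - a$5*b$6"
  "(a \<odot> b) $ 4 = a$0*b$4 + a$4*b$0 + a$5*b$1 - a$1*b$5 + a$6*b$2 - a$2*b$6 + a$7*b$3 - a$3*b$7"
  "(a \<odot> b) $ 5 = a$0*b$5 + a$5*b$0 + a$1*b$4 - a$4*b$1 + a$7*b$2 - a$2*b$7 + a$3*b$6 - a$6*b$3"
  "(a \<odot> b) $ 6 = a$0*b$6 + a$6*b$0 + a$1*b$7 - a$7*b$1 + a$2*b$4 - a$4*b$2 + a$5*b$3 - a$3*b$5"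
  "(a \<odot> b) $ 7 = a$0*b$7 + a$7*b$0 + a$6*b$1 - a$1*b$6 + a$2*b$5 - a$5*b$2 + a$3*b$4 - a$4*b$3"
  unfolding omult_nth_sum sum_8 oct_basis_mult_nth
  by (simp_all only: distinct_8 simp_thms if_True if_False oct_eps_def oct_triples_def insert_iff
        empty_iff prod.inject)

lemma oim_nth: "oim x $ i = (if i = 0 then 0 else x $ i)"
  unfolding oim_def by (rule sum_oe_nth)

lemma ocnj_nth: "ocnj x $ i = (if i = 0 then x $ 0 else - x $ i)"
  by (simp add: ocnj_def ore_def oim_nth oe_nth)

lemma norm_octonion: "(norm x)\<^sup>2 = (\<Sum>i\<in>UNIV. (x $ i)\<^sup>2)" for x :: octonion
  by (simp add: norm_vec_def L2_set_def sum_nonneg)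

lemma ocnj_omult_omult: "ocnj x \<odot> (x \<odot> y) = (norm x)\<^sup>2 *\<^sub>R y"
  unfolding vec_eq_iff forall_8 norm_octonion sum_8
  by (simp add: omult_nth ocnj_nth power2_eq_square algebra_simps)

lemma omult_ocnj_omult: "x \<odot> (ocnj x \<odot> y) = (norm x)\<^sup>2 *\<^sub>R y"
  unfolding vec_eq_iff forall_8 norm_octonion sum_8
  by (simp add: omult_nth ocnj_nth power2_eq_square algebra_simps)

lemma oe_0_omult: "oe 0 \<odot> y = y" "y \<odot> oe 0 = y"
  unfolding vec_eq_iff forall_8
  by (simp_all add: omult_nth oe_nth)

lemma omult_scaleR: "(c *\<^sub>R x) \<odot> y = c *\<^sub>R (x \<odot> y)" "x \<odot> (c *\<^sub>R y) = c *\<^sub>R (x \<odot> y)"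
  by (simp_all add: omult_def scaleR_sum_right mult.assoc mult.left_commute)

lemma oinv_omult:
  assumes "x \<noteq> 0"
  shows "oinv x \<odot> (x \<odot> y) = y" "x \<odot> (oinv x \<odot> y) = y"
  using assms by (simp_all add: oinv_def omult_scaleR ocnj_omult_omult omult_ocnj_omult)

lemma omult_diff:
  "(x - y) \<odot> z = x \<odot> z - y \<odot> z" "x \<odot> (y - z) = x \<odot> y - x \<odot> z"
  by (simp_all add: omult_def left_diff_distrib right_diff_distrib scaleR_left_diff_distrib sum_subtractf)

definition imag_sphere :: "octonion set" where
  "imag_sphere = {I. ore I = 0 \<and> norm I = 1}"

definition tau :: "octonion \<Rightarrow> complex \<Rightarrow> octonion" where
  "tau I z = Re z *\<^sub>R oe 0 + Im z *\<^sub>R I"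

subsection \<open>Slice functions and stem vectors\<close>

definition slice_sphere :: "octonion set \<Rightarrow> real \<Rightarrow> real \<Rightarrow> octonion set" where
  "slice_sphere \<Omega> a b = {I \<in> imag_sphere. a *\<^sub>R oe 0 + b *\<^sub>R I \<in> \<Omega>}"

definition is_stem_pair ::
    "(octonion \<Rightarrow> octonion) \<Rightarrow> real \<Rightarrow> real \<Rightarrow> octonion set \<Rightarrow> octonion \<times> octonion \<Rightarrow> bool" where
  "is_stem_pair f a b \<Lambda> = (\<lambda>(u, v). \<forall>I\<in>\<Lambda>. f (a *\<^sub>R oe 0 + b *\<^sub>R I) = u + I \<odot> v)"

definition slice_function :: "octonion set \<Rightarrow> (octonion \<Rightarrow> octonion) \<Rightarrow> bool" where
  "slice_function \<Omega> f \<longleftrightarrow>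
    (\<forall>a b. b > 0 \<longrightarrow> (\<forall>\<Lambda>\<in>components (slice_sphere \<Omega> a b). \<exists>p. is_stem_pair f a b \<Lambda> p))"

definition stem_vector ::
    "octonion set \<Rightarrow> (octonion \<Rightarrow> octonion) \<Rightarrow> octonion \<Rightarrow> octonion \<times> octonion" where
  "stem_vector \<Omega> f x =
    (if oim x = 0 then (f x, 0)
     else let a = ore x; b = norm (oim x); I = oim x /\<^sub>R b in
       THE p. is_stem_pair f a b (connected_component_set (slice_sphere \<Omega> a b) I) p)"

text \<open>The description in \<open>stem_vector\<close> is well-defined: existence is the defining property
  of slice functions, uniqueness holds because \<open>\<Omega>\<close> is open.\<close>

lemma is_stem_pair_unique:
  assumes "open \<Omega>" and "b > 0" and I: "I \<in> slice_sphere \<Omega> a b"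
    and p: "is_stem_pair f a b (connected_component_set (slice_sphere \<Omega> a b) I) p"
    and q: "is_stem_pair f a b (connected_component_set (slice_sphere \<Omega> a b) I) q"
  shows "p = q"
proof -
  let ?C = "connected_component_set (slice_sphere \<Omega> a b) I"
  have I0: "I $ 0 = 0" and I1: "norm I = 1" and I\<Omega>: "a *\<^sub>R oe 0 + b *\<^sub>R I \<in> \<Omega>"
    using I by (auto simp: slice_sphere_def imag_sphere_def ore_def)
  obtain w :: octonion where w0: "w $ 0 = 0" and w: "\<And>c. w \<noteq> c *\<^sub>R I"
  proof -
    have "(\<forall>c. oe 1 \<noteq> c *\<^sub>R I) \<or> (\<forall>c. oe 2 \<noteq> c *\<^sub>R I)"
    proof (rule ccontr)
      assume "\<not> ?thesis"
      then obtain c d where c: "oe 1 = c *\<^sub>R I" and d: "oe 2 = d *\<^sub>R I" by blast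
      from arg_cong[OF c, of "\<lambda>v. v $ 1"] have "I $ 1 \<noteq> 0" by (auto simp: axis_def)
      moreover from arg_cong[OF d, of "\<lambda>v. v $ 1"] have "d * I $ 1 = 0" by (simp add: axis_def)
      moreover from arg_cong[OF d, of "\<lambda>v. v $ 2"] have "d \<noteq> 0" by (auto simp: axis_def)
      ultimately show False by simp
    qed
    then show thesis using that[of "oe 1"] that[of "oe 2"] by (auto simp: axis_def)
  qed
  define J where "J t = (I + t *\<^sub>R w) /\<^sub>R norm (I + t *\<^sub>R w)" for t :: real
  have nz: "I + t *\<^sub>R w \<noteq> 0" for t
  proof
    assume *: "I + t *\<^sub>R w = 0"
    then have "t \<noteq> 0" using I1 by auto
    have "w = inverse t *\<^sub>R (t *\<^sub>R w)" using \<open>t \<noteq> 0\<close> by simp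
    also have "t *\<^sub>R w = - I" using * by (simp add: eq_neg_iff_add_eq_0 add.commute)
    finally have "w = (- inverse t) *\<^sub>R I" by simp
    then show False using w by blast
  qed
  have J0: "J 0 = I" using I1 by (simp add: J_def)
  have JS: "J t \<in> imag_sphere" for t
    using nz[of t] I0 w0 by (simp add: J_def imag_sphere_def ore_def)
  have JI: "J t \<noteq> I" if "t \<noteq> 0" for t
  proof
    define r where "r = norm (I + t *\<^sub>R w)"
    assume "J t = I"
    have "I + t *\<^sub>R w = r *\<^sub>R J t" using nz[of t] by (simp add: J_def r_def)
    then have "t *\<^sub>R w = (r - 1) *\<^sub>R I"
      using \<open>J t = I\<close> by (simp add: algebra_simps)
    then have "inverse t *\<^sub>R (t *\<^sub>R w) = (inverse t * (r - 1)) *\<^sub>R I" by simp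
    then have "w = (inverse t * (r - 1)) *\<^sub>R I" using that by simp
    then show False using w by blast
  qed
  have cont: "continuous_on UNIV J"
    unfolding J_def by (intro continuous_intros) (use nz in auto)
  have "continuous_on UNIV (\<lambda>t. a *\<^sub>R oe 0 + b *\<^sub>R J t)"
    by (intro continuous_intros cont)
  then have "open ((\<lambda>t. a *\<^sub>R oe 0 + b *\<^sub>R J t) -` \<Omega>)"
    using \<open>open \<Omega>\<close> by (simp add: open_vimage)
  then obtain e where "e > 0" and e: "cball 0 e \<subseteq> (\<lambda>t. a *\<^sub>R oe 0 + b *\<^sub>R J t) -` \<Omega>"
    using I\<Omega> J0 by (metis open_contains_cball vimage_eq)
  have "J ` cball 0 e \<subseteq> slice_sphere \<Omega> a b"
    using e JS by (auto simp: slice_sphere_def)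
  moreover have "connected (J ` cball 0 e)"
    by (intro connected_continuous_image continuous_on_subset[OF cont]) auto
  moreover have "I \<in> J ` cball 0 e" using J0 \<open>e > 0\<close> by force
  ultimately have sub: "J ` cball 0 e \<subseteq> ?C" by (simp add: connected_component_maximal)
  have IC: "I \<in> ?C" using I by simp
  have KC: "J e \<in> ?C" using \<open>e > 0\<close> by (intro subsetD[OF sub] imageI) simp
  obtain u v u' v' where pq: "p = (u, v)" "q = (u', v')" by fastforce
  have 1: "u + K \<odot> v = u' + K \<odot> v'" if "K \<in> ?C" for K
    using p q that unfolding pq is_stem_pair_def by force
  have 2: "K \<odot> v - K \<odot> v' = u' - u" if "K \<in> ?C" for K
    using 1[OF that] by (metis add.commute add_diff_cancel_left' add_diff_eq diff_diff_eq2)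
  have "(J e - I) \<odot> (v - v') = (J e \<odot> v - J e \<odot> v') - (I \<odot> v - I \<odot> v')"
    by (simp add: omult_diff)
  also have "\<dots> = 0"
    unfolding 2[OF IC] 2[OF KC] by simp
  finally have "v - v' = 0"
    using oinv_omult(1)[of "J e - I" "v - v'"] JI[of e] \<open>e > 0\<close> omult_scaleR(2)[of _ 0 0]
    by simp
  then show ?thesis using 1[OF IC] by (simp add: pq)
qed

lemma stem_vector_is_stem_pair:
  assumes "open \<Omega>" "slice_function \<Omega> f" "x \<in> \<Omega>" "oim x \<noteq> 0"
  defines "b \<equiv> norm (oim x)"
  shows "is_stem_pair f (ore x) b
    (connected_component_set (slice_sphere \<Omega> (ore x) b) (oim x /\<^sub>R b)) (stem_vector \<Omega> f x)"
proof -
  let ?I = "oim x /\<^sub>R b"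
  have b: "b > 0" using assms by simp
  have "oim x $ 0 = 0" by (simp add: oim_nth)
  moreover have "x = ore x *\<^sub>R oe 0 + oim x"
    by (simp add: vec_eq_iff ore_def oim_nth oe_nth)
  ultimately have I: "?I \<in> slice_sphere \<Omega> (ore x) b"
    using b \<open>x \<in> \<Omega>\<close> by (auto simp: slice_sphere_def imag_sphere_def ore_def b_def)
  then have "connected_component_set (slice_sphere \<Omega> (ore x) b) ?I
      \<in> components (slice_sphere \<Omega> (ore x) b)"
    by (rule componentsI)
  then obtain p where p: "is_stem_pair f (ore x) b
      (connected_component_set (slice_sphere \<Omega> (ore x) b) ?I) p"
    using \<open>slice_function \<Omega> f\<close> b unfolding slice_function_def by blast
  have "stem_vector \<Omega> f x = (THE p. is_stem_pair f (ore x) b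
      (connected_component_set (slice_sphere \<Omega> (ore x) b) ?I) p)"
    using assms(4) by (simp add: stem_vector_def Let_def b_def)
  also have "\<dots> = p"
    using p is_stem_pair_unique[OF assms(1) b I] by blast
  finally show ?thesis using p by simp
qed

subsection \<open>Slice Fueter-regularity\<close>

definition opartial :: "8 \<Rightarrow> (octonion \<Rightarrow> octonion) \<Rightarrow> octonion \<Rightarrow> octonion" where
  "opartial l f x = vector_derivative (\<lambda>t. f (x + t *\<^sub>R oe l)) (at 0)"

definition C1_on :: "octonion set \<Rightarrow> (octonion \<Rightarrow> octonion) \<Rightarrow> bool" where
  "C1_on \<Omega> f \<longleftrightarrow>
    (\<exists>D. (\<forall>x\<in>\<Omega>. (f has_derivative blinfun_apply (D x)) (at x)) \<and> continuous_on \<Omega> D)"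

definition spherical_L :: "8 \<Rightarrow> 8 \<Rightarrow> (octonion \<Rightarrow> octonion) \<Rightarrow> octonion \<Rightarrow> octonion" where
  "spherical_L m n f x = x $ m *\<^sub>R opartial n f x - x $ n *\<^sub>R opartial m f x"

definition spherical_Gamma :: "(octonion \<Rightarrow> octonion) \<Rightarrow> octonion \<Rightarrow> octonion" where
  "spherical_Gamma f x = - (\<Sum>m\<in>{1..7}. \<Sum>n\<in>{m<..7}. oe m \<odot> (oe n \<odot> spherical_L m n f x))"

definition euler_E :: "(octonion \<Rightarrow> octonion) \<Rightarrow> octonion \<Rightarrow> octonion" where
  "euler_E f x = (\<Sum>l\<in>{1..7}. x $ l *\<^sub>R opartial l f x)"

definition dbar_F :: "(octonion \<Rightarrow> octonion) \<Rightarrow> octonion \<Rightarrow> octonion" where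
  "dbar_F f x = opartial 0 f x - oinv (oim x) \<odot> euler_E f x
     - (1/3) *\<^sub>R (oinv (oim x) \<odot> spherical_Gamma f x)"

definition slice_Fueter_regular :: "octonion set \<Rightarrow> (octonion \<Rightarrow> octonion) \<Rightarrow> bool" where
  "slice_Fueter_regular \<Omega> f \<longleftrightarrow>
    slice_function \<Omega> f \<and> C1_on \<Omega> f \<and> (\<forall>x\<in>\<Omega>. oim x \<noteq> 0 \<longrightarrow> dbar_F f x = 0)"

subsection \<open>CCL equivalence\<close>

definition circular_lifting ::
    "(real \<Rightarrow> complex) \<Rightarrow> (real \<Rightarrow> octonion) \<Rightarrow> real \<Rightarrow> octonion" where
  "circular_lifting \<gamma> \<Theta> = (\<lambda>t. tau (\<Theta> t) (\<gamma> t))"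

definition CCL_connected :: "octonion set \<Rightarrow> octonion \<Rightarrow> octonion \<Rightarrow> bool" where
  "CCL_connected \<Omega> x1 x2 \<longleftrightarrow>
    x1 \<in> \<Omega> \<and> x2 \<in> \<Omega> \<and>
    (\<exists>\<gamma> \<Theta>1 \<Theta>2.
       path \<gamma> \<and>
       path \<Theta>1 \<and> path_image \<Theta>1 \<subseteq> imag_sphere \<and>
       path \<Theta>2 \<and> path_image \<Theta>2 \<subseteq> imag_sphere \<and>
       pathstart \<Theta>1 = pathstart \<Theta>2 \<and>
       path_image (circular_lifting \<gamma> \<Theta>1) \<subseteq> \<Omega> \<and>
       path_image (circular_lifting \<gamma> \<Theta>2) \<subseteq> \<Omega> \<and>
       pathfinish (circular_lifting \<gamma> \<Theta>1) = x1 \<and>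
       pathfinish (circular_lifting \<gamma> \<Theta>2) = x2)"

definition CCL_equivalent :: "octonion set \<Rightarrow> octonion \<Rightarrow> octonion \<Rightarrow> bool" where
  "CCL_equivalent \<Omega> x x' \<longleftrightarrow> x \<in> \<Omega> \<and> x' \<in> \<Omega> \<and> (CCL_connected \<Omega>)\<^sup>*\<^sup>* x x'"

end

theory Submission
  imports Defs "HOL-Complex_Analysis.Conformal_Mappings"
begin

text \<open>Near a non-real point a slice function has the form \<open>f (a + b I) = u (a, b) + I v (a, b)\<close>, and
  evaluating \<open>dbar_F f = 0\<close> at two different units \<open>I\<close> gives the system
  \<open>u\<^sub>a - v\<^sub>b = 2 v / b\<close>, \<open>v\<^sub>a + u\<^sub>b = 0\<close> for each real coordinate. By the second equation there is a
  function \<open>P\<close> with \<open>P\<^sub>a = u\<close> and \<open>P\<^sub>b = - v\<close>, and then \<open>b u + i (b v - P)\<close> is holomorphic; hence the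
  system has the unique continuation property. Along two coupled circular liftings, the condition
  that the two stem functions agree near the base point is therefore open and closed: at non-real
  base points by unique continuation, at real ones because all units near the point give the same
  stem vector. It holds at the common starting point.\<close>

subsection \<open>Octonion algebra\<close>

lemma bounded_bilinear_omult: "bounded_bilinear (\<odot>)"
proof -
  have "bilinear (\<odot>)"
    unfolding bilinear_def linear_iff
    by (simp add: omult_scaleR) (simp add: omult_def distrib_left distrib_right scaleR_left_distrib sum.distrib)
  then show ?thesis by (simp add: bilinear_conv_bounded_bilinear)
qed

interpretation omult: bounded_bilinear "(\<odot>)" by (rule bounded_bilinear_omult)

lemma oim_eq_diff: "oim x = x - ore x *\<^sub>R oe 0"
  by (simp add: vec_eq_iff oim_nth ore_def oe_nth)

text \<open>Since \<open>ocnj x = - x\<close> for imaginary \<open>x\<close>, left alternativity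
  gives the square of a left multiplication without any use of associativity.\<close>

lemma imaginary_omult_omult:
  assumes "x $ 0 = 0"
  shows "x \<odot> (x \<odot> y) = - ((norm x)\<^sup>2 *\<^sub>R y)"
proof -
  have "ocnj x = - x" using assms by (simp add: vec_eq_iff ocnj_nth)
  then show ?thesis using ocnj_omult_omult[of x y] by (metis add.inverse_inverse omult.minus_left)
qed

text \<open>Polarisation of the previous identity: for orthogonal \<open>x\<close> and
  \<open>y\<close> the squared norm of \<open>x + y\<close> splits, so the cross terms cancel. Left
  multiplications by imaginary octonions thus obey the Clifford relations although the product is
  not associative.\<close>

lemma imaginary_omult_anticommute:
  assumes "x $ 0 = 0" "y $ 0 = 0" "x \<bullet> y = 0"
  shows "x \<odot> (y \<odot> z) = - (y \<odot> (x \<odot> z))"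
proof -
  have "(norm (x + y))\<^sup>2 = (norm x)\<^sup>2 + (norm y)\<^sup>2"
    using assms by (simp add: power2_norm_eq_inner inner_add_left inner_add_right inner_commute)
  then have "(x + y) \<odot> ((x + y) \<odot> z) = x \<odot> (x \<odot> z) + y \<odot> (y \<odot> z)"
    using imaginary_omult_omult[of "x + y" z] imaginary_omult_omult[of x z] imaginary_omult_omult[of y z] assms
    by (simp add: algebra_simps)
  then show ?thesis
    by (simp add: omult.add_left omult.add_right eq_neg_iff_add_eq_0 add.commute)
qed

text \<open>By the Clifford relations each pair of indices contributes minus the two terms belonging
  to these indices, and each of the seven indices lies in six pairs. This is what evaluates
  \<open>spherical_Gamma\<close> on slice values.\<close>

lemma spherical_basis_sum:
  assumes "y $ 0 = 0"
  shows "(\<Sum>m\<in>{1..7::8}. \<Sum>n\<in>{m<..7}. oe m \<odot> (oe n \<odot> ((y $ m *\<^sub>R oe n - y $ n *\<^sub>R oe m) \<odot> v))) = - 6 *\<^sub>R (y \<odot> v)"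
proof -
  have t: "oe m \<odot> (oe n \<odot> ((y $ m *\<^sub>R oe n - y $ n *\<^sub>R oe m) \<odot> v)) = - (y $ m *\<^sub>R (oe m \<odot> v)) - y $ n *\<^sub>R (oe n \<odot> v)"
    if "m \<noteq> 0" "n \<noteq> 0" "m \<noteq> n" for m n :: 8
  proof -
    have "oe n \<odot> (oe n \<odot> v) = - v"
      using imaginary_omult_omult[of "oe n" v] that by (simp add: oe_nth)
    moreover have "oe m \<odot> (oe n \<odot> (oe m \<odot> v)) = oe n \<odot> v"
    proof -
      have "oe m \<odot> (oe n \<odot> (oe m \<odot> v)) = - (oe n \<odot> (oe m \<odot> (oe m \<odot> v)))"
        using that by (intro imaginary_omult_anticommute) (auto simp: oe_nth inner_axis)
      also have "\<dots> = oe n \<odot> v"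
        using imaginary_omult_omult[of "oe m" v] that by (simp add: oe_nth omult.minus_right)
      finally show ?thesis .
    qed
    ultimately show ?thesis
      by (simp add: omult.diff_left omult.diff_right omult_scaleR omult.minus_right)
  qed
  have gt: "{m<..7::8} = {n \<in> {1..7}. m < n}" if "m \<noteq> 0" for m
  proof -
    have "\<forall>m::8. m \<noteq> 0 \<longrightarrow> (\<forall>n. m < n \<longrightarrow> 1 \<le> n)"
      unfolding forall_8
      by (simp add: less_eq_bit0_def less_bit0_def bit0.Rep_numeral bit0.Rep_0 bit0.Rep_1)
    then show ?thesis using that by auto
  qed
  have "(\<Sum>m\<in>{1..7::8}. \<Sum>n\<in>{m<..7}. oe m \<odot> (oe n \<odot> ((y $ m *\<^sub>R oe n - y $ n *\<^sub>R oe m) \<odot> v)))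
     = (\<Sum>m\<in>UNIV-{0::8}. \<Sum>n\<in>UNIV-{0}. if m < n then - (y $ m *\<^sub>R (oe m \<odot> v)) - y $ n *\<^sub>R (oe n \<odot> v) else 0)"
  proof (rule sum.cong)
    fix m :: 8 assume m: "m \<in> UNIV - {0}"
    have "(\<Sum>n\<in>{m<..7}. oe m \<odot> (oe n \<odot> ((y $ m *\<^sub>R oe n - y $ n *\<^sub>R oe m) \<odot> v))) =
      (\<Sum>n\<in>{n \<in> UNIV - {0}. m < n}. oe m \<odot> (oe n \<odot> ((y $ m *\<^sub>R oe n - y $ n *\<^sub>R oe m) \<odot> v)))"
      using m gt[of m] by (simp add: atLeastAtMost_8)
    also have "\<dots> = (\<Sum>n\<in>{n \<in> UNIV - {0}. m < n}. - (y $ m *\<^sub>R (oe m \<odot> v)) - y $ n *\<^sub>R (oe n \<odot> v))"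
      using m by (intro sum.cong refl t) auto
    finally show "(\<Sum>n\<in>{m<..7}. oe m \<odot> (oe n \<odot> ((y $ m *\<^sub>R oe n - y $ n *\<^sub>R oe m) \<odot> v))) =
       (\<Sum>n\<in>UNIV - {0}. if m < n then - (y $ m *\<^sub>R (oe m \<odot> v)) - y $ n *\<^sub>R (oe n \<odot> v) else 0)"
      by (simp only: sum.inter_filter[OF finite])
  qed (simp add: atLeastAtMost_8)
  also have "\<dots> = - 6 *\<^sub>R (\<Sum>m\<in>UNIV-{0::8}. y $ m *\<^sub>R (oe m \<odot> v))"
  proof -
    have "(\<Sum>m\<in>UNIV-{0::8}. \<Sum>n\<in>UNIV-{0}. if m < n then - w m - w n else 0) = - 6 *\<^sub>R (\<Sum>m\<in>UNIV-{0}. w m)"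
      for w :: "8 \<Rightarrow> octonion"
      unfolding sum_8_nonzero vec_eq_iff
      by (simp add: less_bit0_def bit0.Rep_numeral bit0.Rep_0 bit0.Rep_1)
    then show ?thesis .
  qed
  also have "(\<Sum>m\<in>UNIV-{0::8}. y $ m *\<^sub>R (oe m \<odot> v)) = oim y \<odot> v"
    by (simp add: oim_def omult.sum_left omult_scaleR)
  also have "oim y = y" using assms by (simp add: oim_eq_diff ore_def)
  finally show ?thesis .
qed

subsection \<open>Spheres of imaginary units and slice values\<close>

lemma tau_simps:
  assumes "I \<in> imag_sphere"
  shows "ore (tau I z) = Re z" "oim (tau I z) = Im z *\<^sub>R I" "norm (oim (tau I z)) = \<bar>Im z\<bar>"
proof -
  have I: "I $ 0 = 0" "norm I = 1" using assms by (auto simp: imag_sphere_def ore_def)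
  show "ore (tau I z) = Re z" by (simp add: tau_def ore_def oe_nth I)
  show "oim (tau I z) = Im z *\<^sub>R I" by (simp add: tau_def oim_nth vec_eq_iff oe_nth I)
  then show "norm (oim (tau I z)) = \<bar>Im z\<bar>" by (simp add: I)
qed

lemma bounded_linear_tau: "bounded_linear (tau I)"
  unfolding tau_def
  by (intro bounded_linear_add bounded_linear_compose[OF bounded_linear_scaleR_left] bounded_linear_Re bounded_linear_Im)

text \<open>A point described by (I, z) is also described by (-I, cnj z). This symmetry reduces
  bases in the lower half plane to the upper one, where stem pairs are defined.\<close>

lemma tau_uminus_cnj: "tau (- I) (cnj z) = tau I z"
  by (simp add: tau_def)

lemma uminus_imag_sphere: "I \<in> imag_sphere \<Longrightarrow> - I \<in> imag_sphere"
  by (simp add: imag_sphere_def ore_def)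

text \<open>1 and I are orthonormal, so \<open>tau I\<close> is an isometric embedding. Around a
  real point this makes distances independent of the unit.\<close>

lemma norm_tau:
  assumes "I \<in> imag_sphere"
  shows "norm (tau I z) = cmod z"
proof -
  have "I $ 0 = 0" "norm I = 1" using assms by (auto simp: imag_sphere_def ore_def)
  then have "oe 0 \<bullet> I = 0" "I \<bullet> oe 0 = 0" "I \<bullet> I = 1" "oe 0 \<bullet> (oe 0 :: octonion) = 1"
    by (simp_all add: inner_axis inner_axis' norm_eq_1)
  then have "(norm (tau I z))\<^sup>2 = (Re z)\<^sup>2 + (Im z)\<^sup>2"
    unfolding power2_norm_eq_inner tau_def
    by (simp add: inner_add_left inner_add_right power2_eq_square)
  then show ?thesis by (simp add: cmod_def real_sqrt_unique)
qed

text \<open>The sphere is the image of a punctured hyperplane of dimension 7 under normalisation,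
  and puncturing leaves a convex set of dimension at least 2 connected.\<close>

lemma connected_imag_sphere: "connected imag_sphere"
proof -
  let ?H = "{x :: octonion. oe 0 \<bullet> x = 0}"
  have "aff_dim ?H = 7" by (subst aff_dim_hyperplane) (auto simp: axis_eq_0_iff)
  then have "connected (?H - {0})"
    by (intro connected_punctured_convex convex_hyperplane) simp
  then have "connected ((\<lambda>x. x /\<^sub>R norm x) ` (?H - {0}))"
    by (intro connected_continuous_image continuous_intros) auto
  also have "(\<lambda>x. x /\<^sub>R norm x) ` (?H - {0}) = imag_sphere"
  proof (intro equalityI subsetI)
    fix I assume "I \<in> imag_sphere"
    then show "I \<in> (\<lambda>x. x /\<^sub>R norm x) ` (?H - {0})"
      by (intro image_eqI[of _ _ I]) (auto simp: imag_sphere_def ore_def inner_axis')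
  qed (auto simp: imag_sphere_def ore_def inner_axis')
  finally show ?thesis .
qed

text \<open>A connected set with more than one point has no isolated point. A second unit close to a
  given one is what separates the two components of a stem vector.\<close>

lemma exists_near_imag_sphere:
  assumes "I \<in> imag_sphere" "e > 0"
  shows "\<exists>J\<in>imag_sphere. J \<noteq> I \<and> dist J I < e"
proof -
  have "imag_sphere \<noteq> {x}" for x
  proof
    assume eq: "imag_sphere = {x}"
    have "oe 1 \<in> imag_sphere" "oe 2 \<in> imag_sphere"
      by (simp_all add: imag_sphere_def ore_def oe_nth)
    then have "(oe 1 :: octonion) = oe 2" unfolding eq by simp
    then show False by (simp add: axis_eq_axis)
  qed
  then have "I islimpt imag_sphere"
    using connected_imp_perfect[OF connected_imag_sphere assms(1)] by blast
  then show ?thesis using assms(2) by (auto simp: islimpt_approachable)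
qed

text \<open>\<open>K\<close> is the radial projection of a convex set, the ball cut with the
  imaginary hyperplane; the ball avoids 0 because its radius is at most 1. Projection moves a point
  by the deviation of its norm from 1, hence by at most its distance to I, which explains the factor
  2.\<close>

lemma connected_cap:
  assumes "I \<in> imag_sphere" "0 < e" "e \<le> 1"
  shows "\<exists>K. connected K \<and> imag_sphere \<inter> ball I e \<subseteq> K \<and> K \<subseteq> imag_sphere \<inter> ball I (2 * e)"
proof -
  let ?N = "\<lambda>x :: octonion. x /\<^sub>R norm x"
  let ?B = "{x. oe 0 \<bullet> x = 0} \<inter> ball I e"
  have I1: "norm I = 1" using assms by (simp add: imag_sphere_def)
  have nz: "x \<noteq> 0" if "x \<in> ?B" for x
    using that assms I1 by (auto simp: dist_norm)
  have "connected ?B"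
    by (intro convex_connected convex_Int convex_hyperplane convex_ball)
  then have "connected (?N ` ?B)"
    by (rule connected_continuous_image[rotated]) (intro continuous_intros, use nz in auto)
  moreover have "imag_sphere \<inter> ball I e \<subseteq> ?N ` ?B"
  proof
    fix x assume "x \<in> imag_sphere \<inter> ball I e"
    then show "x \<in> ?N ` ?B"
      by (intro image_eqI[of _ _ x]) (auto simp: imag_sphere_def ore_def inner_axis')
  qed
  moreover have "?N ` ?B \<subseteq> imag_sphere \<inter> ball I (2 * e)"
  proof clarify
    fix x assume x: "oe 0 \<bullet> x = 0" "x \<in> ball I e"
    then have "x \<noteq> 0" using nz by auto
    have "x - ?N x = (norm x - 1) *\<^sub>R ?N x" using \<open>x \<noteq> 0\<close> by (simp add: algebra_simps)
    moreover have "norm (?N x) = 1" using \<open>x \<noteq> 0\<close> by simp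
    ultimately have "dist x (?N x) = \<bar>norm x - norm I\<bar>"
      unfolding I1 by (metis dist_norm norm_scaleR mult.right_neutral)
    also have "\<dots> \<le> dist x I" using norm_triangle_ineq3[of x I] by (simp add: dist_norm)
    finally have "dist I (?N x) < 2 * e"
      using dist_triangle[of I "?N x" x] x(2) by (simp add: dist_commute)
    then show "?N x \<in> imag_sphere \<inter> ball I (2 * e)"
      using x \<open>x \<noteq> 0\<close> by (simp add: imag_sphere_def ore_def inner_axis')
  qed
  ultimately show ?thesis by blast
qed

section \<open>Recovering stem vectors from slice values\<close>

text \<open>Subtracting the two equations gives (I - J)(q - q') = 0, and the octonions have no zero
  divisors.\<close>

lemma slice_values_unique:
  assumes "I \<noteq> J" "p + I \<odot> q = p' + I \<odot> q'" "p + J \<odot> q = p' + J \<odot> q'"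
  shows "p = p'" "q = q'"
proof -
  have "(I - J) \<odot> (q - q') = (p + I \<odot> q) - (p' + I \<odot> q') - ((p + J \<odot> q) - (p' + J \<odot> q'))"
    by (simp add: omult.diff_left omult.diff_right)
  also have "\<dots> = 0" using assms by simp
  finally have "q - q' = 0"
    using oinv_omult(1)[of "I - J" "q - q'"] assms(1) by (simp add: omult.zero_right)
  then show "q = q'" by simp
  then show "p = p'" using assms by simp
qed

text \<open>A connected set \<open>T\<close> of units over z lies in a single component of the slice
  sphere, so the stem vector at one of its units represents f at all of them.\<close>

lemma stem_vector_tau:
  assumes "open \<Omega>" "slice_function \<Omega> f" "Im z > 0"
    and T: "connected T" "T \<subseteq> imag_sphere" "\<And>K. K \<in> T \<Longrightarrow> tau K z \<in> \<Omega>"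
    and IJ: "I \<in> T" "J \<in> T"
  shows "f (tau J z) = fst (stem_vector \<Omega> f (tau I z)) + J \<odot> snd (stem_vector \<Omega> f (tau I z))"
proof -
  have I: "I \<in> imag_sphere" "tau I z \<in> \<Omega>" using IJ T by auto
  then have "I \<noteq> 0" by (auto simp: imag_sphere_def)
  then have "oim (tau I z) \<noteq> 0" using assms(3) tau_simps(2)[OF I(1), of z] by simp
  from stem_vector_is_stem_pair[OF assms(1,2) I(2) this]
  have "is_stem_pair f (Re z) (Im z) (connected_component_set (slice_sphere \<Omega> (Re z) (Im z)) I)
     (stem_vector \<Omega> f (tau I z))"
    using assms(3) I(1) by (simp add: tau_simps[OF I(1)] imag_sphere_def)
  moreover have "T \<subseteq> connected_component_set (slice_sphere \<Omega> (Re z) (Im z)) I"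
    using T IJ by (intro connected_component_maximal) (auto simp: slice_sphere_def tau_def)
  ultimately show ?thesis
    using IJ(2) unfolding is_stem_pair_def tau_def by (auto simp: split_def)
qed

text \<open>When all units over z are admissible, the slice sphere is the whole connected sphere:
  one component, hence one stem pair. On the real axis \<open>tau\<close> does not depend on the
  unit, and the lower half plane follows by passing to (-I, cnj z).\<close>

lemma stem_vector_independent_near_real:
  assumes "open \<Omega>" "slice_function \<Omega> f"
    and T: "\<And>K. K \<in> imag_sphere \<Longrightarrow> tau K z \<in> \<Omega>"
    and IJ: "I \<in> imag_sphere" "J \<in> imag_sphere"
  shows "stem_vector \<Omega> f (tau I z) = stem_vector \<Omega> f (tau J z)"
proof -
  have pos: "stem_vector \<Omega> f (tau I z) = stem_vector \<Omega> f (tau J z)"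
    if "Im z > 0" and T: "\<And>K. K \<in> imag_sphere \<Longrightarrow> tau K z \<in> \<Omega>"
      and IJ: "I \<in> imag_sphere" "J \<in> imag_sphere" for z I J
  proof -
    have st: "f (tau J z) = fst (stem_vector \<Omega> f (tau I z)) + J \<odot> snd (stem_vector \<Omega> f (tau I z))"
      if "I \<in> imag_sphere" "J \<in> imag_sphere" for I J
      using stem_vector_tau[OF assms(1,2) \<open>Im z > 0\<close> connected_imag_sphere subset_refl] T that by blast
    obtain K where "K \<in> imag_sphere" "K \<noteq> I"
      using exists_near_imag_sphere[OF IJ(1), of 1] by auto
    then show ?thesis
      using slice_values_unique[of I K] st[OF IJ(1,1)] st[OF IJ(2,1)] st[OF IJ(1), of K] st[OF IJ(2), of K] IJ
      by (metis prod_eq_iff)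
  qed
  consider "Im z > 0" | "Im z = 0" | "Im z < 0" by linarith
  then show ?thesis
  proof cases
    case 1
    then show ?thesis using pos T IJ by blast
  next
    case 2
    then show ?thesis by (simp add: tau_def)
  next
    case 3
    have "stem_vector \<Omega> f (tau (- I) (cnj z)) = stem_vector \<Omega> f (tau (- J) (cnj z))"
    proof (rule pos)
      show "tau K (cnj z) \<in> \<Omega>" if "K \<in> imag_sphere" for K
        using T[OF uminus_imag_sphere[OF that]] tau_uminus_cnj[of "- K" z] by simp
    qed (use 3 IJ uminus_imag_sphere in auto)
    then show ?thesis by (simp add: tau_uminus_cnj)
  qed
qed

section \<open>Slice values under the operator \<open>dbar_F\<close>\<close>

text \<open>Differentiating \<open>f (tau K z) = u + K \<odot> v\<close> along great circles through \<open>I\<close>.\<close>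

lemma tangential_derivative:
  assumes I: "I \<in> imag_sphere" and r: "r > 0" and z: "Im z > 0"
    and f: "\<And>K. K \<in> imag_sphere \<Longrightarrow> dist K I < r \<Longrightarrow> f (tau K z) = u + K \<odot> v"
    and D: "(f has_derivative D) (at (tau I z))"
    and h: "h $ 0 = 0" "I \<bullet> h = 0"
  shows "D h = (1 / Im z) *\<^sub>R (h \<odot> v)"
proof -
  interpret D: linear D using D has_derivative_bounded_linear bounded_linear.linear by blast
  have I': "I $ 0 = 0" "norm I = 1" using I by (auto simp: imag_sphere_def ore_def)
  have unit: "D k = (1 / Im z) *\<^sub>R (k \<odot> v)" if k: "norm k = 1" "k $ 0 = 0" "I \<bullet> k = 0" for k
  proof -
    define K where "K t = cos t *\<^sub>R I + sin t *\<^sub>R k" for t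
    have KS: "K t \<in> imag_sphere" for t
    proof -
      have "(norm (K t))\<^sup>2 = (cos t)\<^sup>2 * (I \<bullet> I) + (sin t)\<^sup>2 * (k \<bullet> k)"
        unfolding power2_norm_eq_inner K_def using k(3)
        by (simp add: inner_add_left inner_add_right inner_commute power2_eq_square)
      also have "\<dots> = 1" using I'(2) k(1) by (simp flip: power2_norm_eq_inner)
      finally have "norm (K t) = 1" by (simp add: power2_eq_1_iff) (smt (verit) norm_ge_zero)
      then show ?thesis using I' k by (simp add: imag_sphere_def ore_def K_def)
    qed
    have K0: "K 0 = I" by (simp add: K_def)
    have dK: "(K has_vector_derivative k) (at 0)"
      unfolding K_def by (auto intro!: derivative_eq_intros simp: has_vector_derivative_def)
    have cK: "isCont K 0" using dK by (rule has_vector_derivative_continuous)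
    have "((\<lambda>t. tau (K t) z) has_vector_derivative Im z *\<^sub>R k) (at 0)"
      unfolding tau_def using dK
      by (auto intro!: derivative_eq_intros simp: has_vector_derivative_def)
    then have 1: "((\<lambda>t. f (tau (K t) z)) has_vector_derivative Im z *\<^sub>R D k) (at 0)"
      using has_derivative_compose[of "\<lambda>t. tau (K t) z" "\<lambda>t. t *\<^sub>R (Im z *\<^sub>R k)" 0 UNIV f D] D K0
      by (simp add: has_vector_derivative_def D.scaleR)
    have 2: "((\<lambda>t. u + K t \<odot> v) has_vector_derivative k \<odot> v) (at 0)"
      using has_derivative_add[OF has_derivative_const[of u]
          omult.FDERIV[OF dK[unfolded has_vector_derivative_def] has_derivative_const[of v]]]
      by (simp add: has_vector_derivative_def omult_scaleR omult.zero_right)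
    \<comment> \<open>The slice formula is available only within distance \<open>r\<close> of I, so
      the chain rule and the direct derivative are compared on curves that coincide merely near t =
      0.\<close>
    have "\<forall>\<^sub>F t in at 0. dist (K t) I < r"
      using tendstoD[OF cK[unfolded isCont_def K0] r] .
    then have "\<forall>\<^sub>F t in at 0. u + K t \<odot> v = f (tau (K t) z)"
      by eventually_elim (simp add: f[OF KS])
    then have "((\<lambda>t. f (tau (K t) z)) has_vector_derivative k \<odot> v) (at 0)"
      using 2 f[OF I] r unfolding has_vector_derivative_def
      by (elim has_derivative_transform_eventually) (simp_all add: K0)
    then have "Im z *\<^sub>R D k = k \<odot> v" using 1 vector_derivative_unique_at by blast
    then have "(1 / Im z) *\<^sub>R Im z *\<^sub>R D k = (1 / Im z) *\<^sub>R (k \<odot> v)" by simp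
    then show ?thesis using z by simp
  qed
  show ?thesis
  proof (cases "h = 0")
    case True
    then show ?thesis by (simp add: D.zero omult.zero_left)
  next
    case False
    then have "D (h /\<^sub>R norm h) = (1 / Im z) *\<^sub>R ((h /\<^sub>R norm h) \<odot> v)"
      using h by (intro unit) auto
    then have "norm h *\<^sub>R D (h /\<^sub>R norm h) = norm h *\<^sub>R (1 / Im z) *\<^sub>R ((h /\<^sub>R norm h) \<odot> v)" by simp
    then show ?thesis using False by (simp add: D.scaleR omult_scaleR)
  qed
qed

text \<open>The Euler operator differentiates along Im z * I, and dividing by the imaginary part
  leaves I D(I). The operators \<open>spherical_L\<close> differentiate along vectors orthogonal to
  I, where the derivative of f is known from v alone; their sum gives 6 I v, so the factor 1/3
  together with I (I v) = - v produces the term 2 v / Im z.\<close>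

lemma dbar_F_slice:
  assumes I: "I \<in> imag_sphere" and r: "r > 0" and z: "Im z > 0"
    and f: "\<And>K. K \<in> imag_sphere \<Longrightarrow> dist K I < r \<Longrightarrow> f (tau K z) = u + K \<odot> v"
    and D: "(f has_derivative D) (at (tau I z))"
  shows "dbar_F f (tau I z) = D (oe 0) + I \<odot> D I - (2 / Im z) *\<^sub>R v"
proof -
  interpret D: linear D using D has_derivative_bounded_linear bounded_linear.linear by blast
  let ?x = "tau I z"
  have I': "I $ 0 = 0" "norm I = 1" using I by (auto simp: imag_sphere_def ore_def)
  have xn: "?x $ n = Im z * I $ n" if "n \<noteq> 0" for n
    using that by (simp add: tau_def oe_nth)
  have op: "opartial l f ?x = D (oe l)" for l
  proof -
    have "((\<lambda>t. ?x + t *\<^sub>R oe l) has_derivative (\<lambda>t. t *\<^sub>R oe l)) (at 0)"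
      by (auto intro!: derivative_eq_intros)
    then have "((\<lambda>t. f (?x + t *\<^sub>R oe l)) has_vector_derivative D (oe l)) (at 0)"
      using has_derivative_compose[of "\<lambda>t. ?x + t *\<^sub>R oe l" "\<lambda>t. t *\<^sub>R oe l" 0 UNIV f D] D
      by (simp add: has_vector_derivative_def D.scaleR)
    then show ?thesis unfolding opartial_def by (rule vector_derivative_at)
  qed
  have E: "euler_E f ?x = Im z *\<^sub>R D I"
  proof -
    have "euler_E f ?x = D (oim ?x)"
      unfolding euler_E_def op oim_def atLeastAtMost_8 by (simp add: D.sum D.scaleR)
    then show ?thesis by (simp add: tau_simps[OF I] D.scaleR)
  qed
  have L: "spherical_L m n f ?x = (I $ m *\<^sub>R oe n - I $ n *\<^sub>R oe m) \<odot> v" if "m \<noteq> 0" "n \<noteq> 0" for m n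
  proof -
    let ?h = "I $ m *\<^sub>R oe n - I $ n *\<^sub>R oe m"
    have "spherical_L m n f ?x = Im z *\<^sub>R D ?h"
      using that by (simp add: spherical_L_def op xn D.diff D.scaleR scaleR_diff_right)
    also have "D ?h = (1 / Im z) *\<^sub>R (?h \<odot> v)"
      using that by (intro tangential_derivative[OF I r z f D])
        (auto simp: oe_nth inner_diff_right inner_axis)
    finally show ?thesis using z by simp
  qed
  have "spherical_Gamma f ?x = - (\<Sum>m\<in>{1..7}. \<Sum>n\<in>{m<..7}. oe m \<odot> (oe n \<odot> ((I $ m *\<^sub>R oe n - I $ n *\<^sub>R oe m) \<odot> v)))"
    unfolding spherical_Gamma_def
  proof (intro arg_cong[of _ _ uminus] sum.cong refl)
    fix m n :: 8 assume "m \<in> {1..7}" "n \<in> {m<..7}"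
    moreover have "\<forall>m::8. \<not> m < 0"
      unfolding forall_8 by (simp add: less_bit0_def bit0.Rep_numeral bit0.Rep_0 bit0.Rep_1)
    ultimately have "m \<noteq> 0" "n \<noteq> 0" unfolding atLeastAtMost_8 by auto
    then show "oe m \<odot> (oe n \<odot> spherical_L m n f ?x) = oe m \<odot> (oe n \<odot> ((I $ m *\<^sub>R oe n - I $ n *\<^sub>R oe m) \<odot> v))"
      using L by simp
  qed
  then have G: "spherical_Gamma f ?x = 6 *\<^sub>R (I \<odot> v)"
    by (simp add: spherical_basis_sum[OF I'(1)])
  have inv: "oinv (oim ?x) = - (1 / Im z) *\<^sub>R I"
  proof -
    have "ocnj (oim ?x) = - Im z *\<^sub>R I"
      by (simp add: tau_simps[OF I] vec_eq_iff ocnj_nth I')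
    then show ?thesis using z by (simp add: oinv_def tau_simps(3)[OF I] power2_eq_square field_simps)
  qed
  show ?thesis unfolding dbar_F_def op E G inv
    using z imaginary_omult_omult[OF I'(1), of v]
    by (simp add: omult_scaleR omult.minus_left I')
qed

subsection \<open>Unique continuation\<close>

text \<open>The primitive is the integral of the form \<open>u dx - v dy\<close> along the segments issuing from \<open>c\<close>.\<close>

lemma closed_form_has_primitive:
  fixes u v ua ub va vb :: "complex \<Rightarrow> real"
  assumes S: "convex S" "open S" "c \<in> S"
    and du: "\<And>z. z \<in> S \<Longrightarrow> (u has_derivative (\<lambda>h. Re h * ua z + Im h * ub z)) (at z)"
    and dv: "\<And>z. z \<in> S \<Longrightarrow> (v has_derivative (\<lambda>h. Re h * va z + Im h * vb z)) (at z)"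
    and cont: "continuous_on S ua" "continuous_on S ub" "continuous_on S va" "continuous_on S vb"
    and closed: "\<And>z. z \<in> S \<Longrightarrow> va z + ub z = 0"
  shows "\<exists>P. \<forall>z\<in>S. (P has_derivative (\<lambda>h. Re h * u z - Im h * v z)) (at z)"
proof -
  define g where "g z t = c + complex_of_real t * (z - c)" for z t
  have gS: "g z t \<in> S" if "z \<in> S" "t \<in> {0..1}" for z t
  proof -
    have "g z t = (1 - t) *\<^sub>R c + t *\<^sub>R z"
      by (simp add: g_def scaleR_conv_of_real algebra_simps)
    then show ?thesis using convexD[OF S(1) S(3) that(1), of "1 - t" t] that(2) by simp
  qed
  have ucont: "continuous_on S u" "continuous_on S v"
    using du dv by (meson continuous_at_imp_continuous_on has_derivative_continuous)+
  \<comment> \<open>The coordinate functionals as bounded linear maps, since the Leibniz rule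
    differentiates under the integral with values in that space.\<close>
  define BR BI :: "complex \<Rightarrow>\<^sub>L real" where "BR = Blinfun Re" and "BI = Blinfun Im"
  have BR: "blinfun_apply BR h = Re h" and BI: "blinfun_apply BI h = Im h" for h
    unfolding BR_def BI_def by (simp_all add: bounded_linear_Blinfun_apply bounded_linear_Re bounded_linear_Im)
  \<comment> \<open>\<open>A\<close> and \<open>B\<close> are the t-derivatives of t u and t v along
    the segment from c to z.\<close>
  define A where "A z t = u (g z t) + t * (ua (g z t) * Re (z - c) + ub (g z t) * Im (z - c))" for z t
  define B where "B z t = v (g z t) + t * (va (g z t) * Re (z - c) + vb (g z t) * Im (z - c))" for z t
  define F where "F z t = u (g z t) * Re (z - c) - v (g z t) * Im (z - c)" for z t
  define F' where "F' z t = A z t *\<^sub>R BR - B z t *\<^sub>R BI" for z t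
  have "(g z has_vector_derivative (z - c)) (at t within T)" for z t T
    unfolding g_def by (auto intro!: derivative_eq_intros simp: has_vector_derivative_def scaleR_conv_of_real)
  then have dgt: "(g z has_derivative (\<lambda>s. s *\<^sub>R (z - c))) (at t within T)" for z t T
    unfolding has_vector_derivative_def .
  have dgz: "((\<lambda>z. g z t) has_derivative (\<lambda>h. of_real t * h)) (at z within T)" for z t T
    unfolding g_def by (auto intro!: derivative_eq_intros)
  have dF: "((\<lambda>z. F z t) has_derivative blinfun_apply (F' z t)) (at z within S)"
    if "z \<in> S" "t \<in> cbox 0 1" for z t
  proof -
    have t: "t \<in> {0..1}" using that by simp
    \<comment> \<open>Closedness enters here: exchanging the mixed coefficients turns the
      z-derivative of the integrand into an expression in \<open>A\<close> and \<open>B\<close>,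
      that is, into a total t-derivative.\<close>
    have cl: "va (g z t) = - ub (g z t)" using closed[OF gS[OF that(1) t]] by simp
    have "((\<lambda>z. u (g z t)) has_derivative (\<lambda>h. Re (of_real t * h) * ua (g z t) + Im (of_real t * h) * ub (g z t))) (at z within S)"
      using has_derivative_compose[OF dgz du[OF gS[OF that(1) t]]] .
    moreover have "((\<lambda>z. v (g z t)) has_derivative (\<lambda>h. Re (of_real t * h) * va (g z t) + Im (of_real t * h) * vb (g z t))) (at z within S)"
      using has_derivative_compose[OF dgz dv[OF gS[OF that(1) t]]] .
    ultimately have "((\<lambda>z. F z t) has_derivative
      (\<lambda>h. (u (g z t) * Re h + (Re (of_real t * h) * ua (g z t) + Im (of_real t * h) * ub (g z t)) * Re (z - c))
         - (v (g z t) * Im h + (Re (of_real t * h) * va (g z t) + Im (of_real t * h) * vb (g z t)) * Im (z - c))))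
      (at z within S)"
      unfolding F_def
      by (intro has_derivative_diff has_derivative_mult)
        (auto intro!: derivative_eq_intros)
    then show ?thesis
      by (rule has_derivative_eq_rhs)
        (simp add: fun_eq_iff F'_def A_def B_def BR BI blinfun.bilinear_simps cl algebra_simps)
  qed
  have cont2': "continuous_on (S \<times> {0..1}) (\<lambda>x. w (g (fst x) (snd x)))" if "continuous_on S w" for w :: "complex \<Rightarrow> real"
  proof (rule continuous_on_compose2[OF that])
    show "continuous_on (S \<times> {0..1}) (\<lambda>x. g (fst x) (snd x))"
      unfolding g_def by (intro continuous_intros)
  qed (use gS in auto)
  have contF': "continuous_on (S \<times> cbox 0 1) (\<lambda>(z, t). F' z t)"
    unfolding F'_def A_def B_def split_def box_real
    by (intro continuous_intros cont2' cont ucont)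
  have contF: "F z integrable_on cbox 0 1" if "z \<in> S" for z
  proof (rule integrable_continuous)
    have g1: "continuous_on {0..1} (g z)" unfolding g_def by (intro continuous_intros)
    have "continuous_on {0..1} (\<lambda>t. w (g z t))" if "continuous_on S w" for w :: "complex \<Rightarrow> real"
      using continuous_on_compose2[OF that g1] gS[OF \<open>z \<in> S\<close>] by blast
    from this[OF ucont(1)] this[OF ucont(2)] show "continuous_on (cbox 0 1) (F z)"
      unfolding F_def box_real by (intro continuous_intros)
  qed
  have int: "integral (cbox 0 1) (F' z) = u z *\<^sub>R BR - v z *\<^sub>R BI" if "z \<in> S" for z
  proof -
    have "((\<lambda>t. (t * u (g z t)) *\<^sub>R BR - (t * v (g z t)) *\<^sub>R BI) has_vector_derivative F' z t) (at t within {0..1})"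
      if t: "t \<in> {0..1}" for t
    proof -
      have 1: "((\<lambda>t. u (g z t)) has_real_derivative Re (z - c) * ua (g z t) + Im (z - c) * ub (g z t)) (at t within {0..1})"
        unfolding has_field_derivative_def
        by (rule has_derivative_eq_rhs[OF has_derivative_compose[OF dgt du[OF gS[OF \<open>z \<in> S\<close> t]]]])
          (simp add: fun_eq_iff algebra_simps)
      have 2: "((\<lambda>t. v (g z t)) has_real_derivative Re (z - c) * va (g z t) + Im (z - c) * vb (g z t)) (at t within {0..1})"
        unfolding has_field_derivative_def
        by (rule has_derivative_eq_rhs[OF has_derivative_compose[OF dgt dv[OF gS[OF \<open>z \<in> S\<close> t]]]])
          (simp add: fun_eq_iff algebra_simps)
      have 3: "((\<lambda>t. t * u (g z t)) has_real_derivative A z t) (at t within {0..1})"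
        by (rule derivative_eq_intros 1 refl | simp add: A_def algebra_simps)+
      have 4: "((\<lambda>t. t * v (g z t)) has_real_derivative B z t) (at t within {0..1})"
        by (rule derivative_eq_intros 2 refl | simp add: B_def algebra_simps)+
      show ?thesis
        using has_vector_derivative_diff[OF has_vector_derivative_scaleR[OF 3 has_vector_derivative_const[of BR]]
           has_vector_derivative_scaleR[OF 4 has_vector_derivative_const[of BI]]]
        by (simp add: F'_def)
    qed
    \<comment> \<open>The factor t removes the boundary term at t = 0, and at t = 1 the segment has
      reached z.\<close>
    from fundamental_theorem_of_calculus[OF _ this] show ?thesis
      by (simp add: integral_unique g_def)
  qed
  show ?thesis
  proof (intro exI ballI)
    fix z assume z: "z \<in> S"
    have "((\<lambda>z. integral (cbox 0 1) (F z)) has_derivative integral (cbox 0 1) (F' z)) (at z within S)"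
      by (rule leibniz_rule[OF dF contF contF' z S(1)])
    moreover have "blinfun_apply (u z *\<^sub>R BR - v z *\<^sub>R BI) = (\<lambda>h. Re h * u z - Im h * v z)"
      by (simp add: fun_eq_iff blinfun.bilinear_simps BR BI mult.commute)
    ultimately show "((\<lambda>z. integral (cbox 0 1) (F z)) has_derivative (\<lambda>h. Re h * u z - Im h * v z)) (at z)"
      using int[OF z] at_within_open[OF z S(2)] by simp
  qed
qed

text \<open>The primitive is normalised at c, so near c it vanishes together with u and v, and the
  holomorphic function built from it is zero on all of \<open>S\<close>. This gives u = 0 and Im z *
  v = P; a second argument then removes P.\<close>

lemma axial_unique_continuation:
  fixes u v ua ub va vb :: "complex \<Rightarrow> real"
  assumes S: "convex S" "open S"
    and pos: "\<And>z. z \<in> S \<Longrightarrow> Im z > 0"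
    and du: "\<And>z. z \<in> S \<Longrightarrow> (u has_derivative (\<lambda>h. Re h * ua z + Im h * ub z)) (at z)"
    and dv: "\<And>z. z \<in> S \<Longrightarrow> (v has_derivative (\<lambda>h. Re h * va z + Im h * vb z)) (at z)"
    and cont: "continuous_on S ua" "continuous_on S ub" "continuous_on S va" "continuous_on S vb"
    and pde1: "\<And>z. z \<in> S \<Longrightarrow> ua z - vb z = 2 * v z / Im z"
    and pde2: "\<And>z. z \<in> S \<Longrightarrow> va z + ub z = 0"
    and c: "c \<in> S"
    and ev: "\<forall>\<^sub>F z in nhds c. u z = 0 \<and> v z = 0"
    and z: "z \<in> S"
  shows "u z = 0" "v z = 0"
proof -
  obtain P0 where P0: "\<And>z. z \<in> S \<Longrightarrow> (P0 has_derivative (\<lambda>h. Re h * u z - Im h * v z)) (at z)"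
    using closed_form_has_primitive[OF S c du dv cont pde2] by blast
  define P where "P z = P0 z - P0 c" for z
  have P: "(P has_derivative (\<lambda>h. Re h * u z - Im h * v z)) (at z)" if "z \<in> S" for z
    unfolding P_def using P0[OF that] by (auto intro!: derivative_eq_intros)
  have "\<forall>\<^sub>F z in nhds c. z \<in> S \<and> u z = 0 \<and> v z = 0"
    using ev eventually_nhds_in_open[OF S(2) c] by eventually_elim simp
  then obtain d where d: "d > 0" "\<And>z. z \<in> ball c d \<Longrightarrow> z \<in> S \<and> u z = 0 \<and> v z = 0"
    unfolding eventually_nhds_metric by (auto simp: dist_commute)
  have Pz: "P z = 0" if "z \<in> ball c d" for z
  proof -
    have "P z = P c"
    proof (rule has_derivative_zero_unique_connected[of "ball c d"])
      show "(P has_derivative (\<lambda>x. 0)) (at x)" if "x \<in> ball c d" for x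
        using P[of x] d(2)[OF that] by simp
    qed (use that d(1) in auto)
    then show ?thesis by (simp add: P_def)
  qed
  \<comment> \<open>The factor Im z absorbs the singular term: the b-derivative of b v - P is b v_b
    + 2 v = b u_a, and its a-derivative is b v_a - u = - (u + b u_b), which are the Cauchy-Riemann
    equations for \<open>H\<close>.\<close>
  define H where "H z = Complex (Im z * u z) (Im z * v z - P z)" for z
  have H: "(H has_field_derivative Complex (Im z * ua z) (- u z - Im z * ub z)) (at z)" if z: "z \<in> S" for z
  proof -
    have vb: "Im z * vb z = Im z * ua z - 2 * v z"
      using pde1[OF z] pos[OF z] by (simp add: field_simps)
    have va: "va z = - ub z" using pde2[OF z] by simp
    have 1: "((\<lambda>z. Im z * u z) has_derivative (\<lambda>h. Im z * (Re h * ua z + Im h * ub z) + Im h * u z)) (at z)"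
      by (rule derivative_eq_intros du[OF z] refl)+
    have 2: "((\<lambda>z. Im z * v z - P z) has_derivative
        (\<lambda>h. Im z * (Re h * va z + Im h * vb z) + Im h * v z - (Re h * u z - Im h * v z))) (at z)"
      by (rule derivative_eq_intros dv[OF z] P[OF z] refl)+
    have 3: "Im z * (Re h * va z + Im h * vb z) + Im h * v z - (Re h * u z - Im h * v z)
       = Im h * (Im z * ua z) - Re h * (u z + Im z * ub z)" for h
    proof -
      have "Im z * (Re h * va z + Im h * vb z) = - Re h * (Im z * ub z) + Im h * (Im z * vb z)"
        by (simp add: va algebra_simps)
      then show ?thesis by (simp only: vb) (simp add: algebra_simps)
    qed
    have Heq: "H = (\<lambda>z. of_real (Im z * u z) + \<i> * of_real (Im z * v z - P z))"
      by (simp add: H_def fun_eq_iff complex_eq_iff)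
    have "(H has_derivative (\<lambda>h. of_real (Im z * (Re h * ua z + Im h * ub z) + Im h * u z) +
       \<i> * of_real (Im h * (Im z * ua z) - Re h * (u z + Im z * ub z)))) (at z)"
      unfolding Heq using 1 2[unfolded 3]
      by (intro has_derivative_add has_derivative_mult_right has_derivative_of_real)
    then show ?thesis
      unfolding has_field_derivative_def
      by (rule has_derivative_eq_rhs) (simp add: fun_eq_iff complex_eq_iff algebra_simps)
  qed
  have "H holomorphic_on S"
    using H holomorphic_on_open[OF S(2)] by blast
  moreover have "H z = 0" if "z \<in> ball c d" for z
    using d(2)[OF that] Pz[OF that] by (simp add: H_def complex_eq_iff)
  moreover have "ball c d \<subseteq> S" "ball c d \<noteq> {}" using d by (blast, simp)
  ultimately have H0: "H z = 0" if "z \<in> S" for z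
    using analytic_continuation_open[of "ball c d" S H "\<lambda>_. 0"] that S convex_connected by auto
  have uz: "u z = 0" and vP: "Im z * v z = P z" if "z \<in> S" for z
    using H0[OF that] pos[OF that] by (simp_all add: H_def complex_eq_iff)
  \<comment> \<open>\<open>H = 0\<close> still allows u = 0, v = C / b^2, P = C / b. With u = 0 and
    b v = P the differential of b P vanishes, so b P is constant, and its value at c forces C =
    0.\<close>
  have "Im z * P z = Im c * P c"
  proof (rule has_derivative_zero_unique_connected[OF S(2) convex_connected[OF S(1)]])
    fix x assume x: "x \<in> S"
    have "((\<lambda>z. Im z * P z) has_derivative (\<lambda>h. Im x * (Re h * u x - Im h * v x) + Im h * P x)) (at x)"
      by (rule derivative_eq_intros P[OF x] refl)+
    then show "((\<lambda>z. Im z * P z) has_derivative (\<lambda>h. 0)) (at x)"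
      by (rule has_derivative_eq_rhs) (simp add: fun_eq_iff uz[OF x] vP[OF x, symmetric])
  qed (use z c in auto)
  then have "P z = 0" using pos[OF z] by (simp add: P_def)
  then show "u z = 0" "v z = 0" using uz[OF z] vP[OF z] pos[OF z] by auto
qed

section \<open>The first-order system for vector-valued functions\<close>

text \<open>This is the Vekua system of axially symmetric Fueter-regular functions of one
  quaternion; the coefficient 2 is the dimension of the sphere of quaternionic imaginary units. The
  partial derivatives are explicit arguments because their continuity is needed when integrating the
  closed form.\<close>

definition axial_derivatives ::
    "complex set \<Rightarrow> (complex \<Rightarrow> 'a::real_normed_vector) \<Rightarrow> (complex \<Rightarrow> 'a) \<Rightarrow>
     (complex \<Rightarrow> 'a) \<Rightarrow> (complex \<Rightarrow> 'a) \<Rightarrow> (complex \<Rightarrow> 'a) \<Rightarrow> (complex \<Rightarrow> 'a) \<Rightarrow> bool" where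
  "axial_derivatives S u v ua ub va vb \<longleftrightarrow>
    continuous_on S ua \<and> continuous_on S ub \<and> continuous_on S va \<and> continuous_on S vb \<and>
    (\<forall>z\<in>S. (u has_derivative (\<lambda>h. Re h *\<^sub>R ua z + Im h *\<^sub>R ub z)) (at z) \<and>
           (v has_derivative (\<lambda>h. Re h *\<^sub>R va z + Im h *\<^sub>R vb z)) (at z) \<and>
           ua z - vb z = (2 / Im z) *\<^sub>R v z \<and> va z + ub z = 0)"

lemma axial_derivativesD:
  assumes "axial_derivatives S u v ua ub va vb"
  shows "continuous_on S ua" "continuous_on S ub" "continuous_on S va" "continuous_on S vb"
    "\<And>z. z \<in> S \<Longrightarrow> (u has_derivative (\<lambda>h. Re h *\<^sub>R ua z + Im h *\<^sub>R ub z)) (at z)"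
    "\<And>z. z \<in> S \<Longrightarrow> (v has_derivative (\<lambda>h. Re h *\<^sub>R va z + Im h *\<^sub>R vb z)) (at z)"
    "\<And>z. z \<in> S \<Longrightarrow> ua z - vb z = (2 / Im z) *\<^sub>R v z"
    "\<And>z. z \<in> S \<Longrightarrow> va z + ub z = 0"
  using assms unfolding axial_derivatives_def by blast+

definition axial_system :: "complex set \<Rightarrow> (complex \<Rightarrow> 'a::real_normed_vector) \<Rightarrow> (complex \<Rightarrow> 'a) \<Rightarrow> bool" where
  "axial_system S u v \<longleftrightarrow> (\<exists>ua ub va vb. axial_derivatives S u v ua ub va vb)"

lemma axial_system_subset:
  assumes "axial_system S u v" "T \<subseteq> S"
  shows "axial_system T u v"
proof -
  obtain ua ub va vb where "axial_derivatives S u v ua ub va vb"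
    using assms(1) unfolding axial_system_def by blast
  then have "axial_derivatives T u v ua ub va vb"
    using assms(2) unfolding axial_derivatives_def by (blast intro: continuous_on_subset)
  then show ?thesis unfolding axial_system_def by blast
qed

lemma axial_system_diff:
  assumes "axial_system S u v" "axial_system S u' v'"
  shows "axial_system S (\<lambda>z. u z - u' z) (\<lambda>z. v z - v' z)"
proof -
  obtain ua ub va vb where "axial_derivatives S u v ua ub va vb"
    using assms(1) unfolding axial_system_def by blast
  note 1 = axial_derivativesD[OF this]
  obtain ua' ub' va' vb' where "axial_derivatives S u' v' ua' ub' va' vb'"
    using assms(2) unfolding axial_system_def by blast
  note 2 = axial_derivativesD[OF this]
  have "ua z - ua' z - (vb z - vb' z) = (2 / Im z) *\<^sub>R (v z - v' z)" "va z - va' z + (ub z - ub' z) = 0" if "z \<in> S" for z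
  proof -
    have "ua z - ua' z - (vb z - vb' z) = (ua z - vb z) - (ua' z - vb' z)" by simp
    then show "ua z - ua' z - (vb z - vb' z) = (2 / Im z) *\<^sub>R (v z - v' z)"
      by (simp only: 1(7)[OF that] 2(7)[OF that] scaleR_diff_right)
    have "va z - va' z + (ub z - ub' z) = (va z + ub z) - (va' z + ub' z)" by simp
    then show "va z - va' z + (ub z - ub' z) = 0"
      by (simp only: 1(8)[OF that] 2(8)[OF that] diff_self)
  qed
  moreover have "((\<lambda>z. u z - u' z) has_derivative (\<lambda>h. Re h *\<^sub>R (ua z - ua' z) + Im h *\<^sub>R (ub z - ub' z))) (at z)"
    "((\<lambda>z. v z - v' z) has_derivative (\<lambda>h. Re h *\<^sub>R (va z - va' z) + Im h *\<^sub>R (vb z - vb' z))) (at z)" if "z \<in> S" for z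
    using has_derivative_diff[OF 1(5)[OF that] 2(5)[OF that]] has_derivative_diff[OF 1(6)[OF that] 2(6)[OF that]]
    by (simp_all add: algebra_simps)
  ultimately have "axial_derivatives S (\<lambda>z. u z - u' z) (\<lambda>z. v z - v' z)
      (\<lambda>z. ua z - ua' z) (\<lambda>z. ub z - ub' z) (\<lambda>z. va z - va' z) (\<lambda>z. vb z - vb' z)"
    unfolding axial_derivatives_def
    using continuous_on_diff[OF 1(1) 2(1)] continuous_on_diff[OF 1(2) 2(2)]
      continuous_on_diff[OF 1(3) 2(3)] continuous_on_diff[OF 1(4) 2(4)]
    by blast
  then show ?thesis unfolding axial_system_def by blast
qed

text \<open>The coefficients of the system are real, so every coordinate of the difference of two
  solutions solves the scalar system.\<close>

lemma axial_system_unique_continuation: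
  fixes u v u' v' :: "complex \<Rightarrow> real ^ 'n"
  assumes S: "convex S" "open S" "\<And>z. z \<in> S \<Longrightarrow> Im z > 0"
    and ax: "axial_system S u v" "axial_system S u' v'"
    and c: "c \<in> S" "\<forall>\<^sub>F z in nhds c. u z = u' z \<and> v z = v' z"
    and z: "z \<in> S"
  shows "u z = u' z \<and> v z = v' z"
proof -
  obtain ua ub va vb where "axial_derivatives S (\<lambda>z. u z - u' z) (\<lambda>z. v z - v' z) ua ub va vb"
    using axial_system_diff[OF ax] unfolding axial_system_def by blast
  note 1 = axial_derivativesD[OF this]
  note comp = bounded_linear.has_derivative[OF bounded_linear_vec_nth]
  have "(u z - u' z) $ i = 0 \<and> (v z - v' z) $ i = 0" for i
  proof -
    have "continuous_on S (\<lambda>z. ua z $ i)" "continuous_on S (\<lambda>z. ub z $ i)"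
      "continuous_on S (\<lambda>z. va z $ i)" "continuous_on S (\<lambda>z. vb z $ i)"
      using 1(1-4) by (auto intro: continuous_on_component)
    moreover have "((\<lambda>z. (u z - u' z) $ i) has_derivative (\<lambda>h. Re h * ua z $ i + Im h * ub z $ i)) (at z)"
      "((\<lambda>z. (v z - v' z) $ i) has_derivative (\<lambda>h. Re h * va z $ i + Im h * vb z $ i)) (at z)" if "z \<in> S" for z
      using comp[OF 1(5)[OF that], of i] comp[OF 1(6)[OF that], of i] by simp_all
    moreover have "ua z $ i - vb z $ i = 2 * (v z - v' z) $ i / Im z" "va z $ i + ub z $ i = 0" if "z \<in> S" for z
      using arg_cong[OF 1(7)[OF that], of "\<lambda>x. x $ i"] arg_cong[OF 1(8)[OF that], of "\<lambda>x. x $ i"] by simp_all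
    moreover have "\<forall>\<^sub>F z in nhds c. (u z - u' z) $ i = 0 \<and> (v z - v' z) $ i = 0"
      using c(2) by eventually_elim simp
    ultimately show ?thesis
      using axial_unique_continuation[where u = "\<lambda>z. (u z - u' z) $ i" and v = "\<lambda>z. (v z - v' z) $ i"
        and ua = "\<lambda>z. ua z $ i" and ub = "\<lambda>z. ub z $ i" and va = "\<lambda>z. va z $ i" and vb = "\<lambda>z. vb z $ i",
        OF S _ _ _ _ _ _ _ _ c(1) _ z]
      by blast
  qed
  then show ?thesis by (simp add: vec_eq_iff)
qed

subsection \<open>Stem functions and their continuation along liftings\<close>

text \<open>Values of f at two fixed units determine v as (I - J)^(-1) times their difference and
  then u, so both inherit differentiability from f. The vanishing of \<open>dbar_F f\<close> at the
  two units gives two relations of the form A + L B = 0, hence A = B = 0.\<close>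

lemma axial_system_slice:
  assumes IJ: "I \<in> imag_sphere" "J \<in> imag_sphere" "I \<noteq> J"
    and S: "open S" "\<And>z. z \<in> S \<Longrightarrow> Im z > 0" "\<And>z. z \<in> S \<Longrightarrow> tau I z \<in> \<Omega>" "\<And>z. z \<in> S \<Longrightarrow> tau J z \<in> \<Omega>"
    and reg: "C1_on \<Omega> f" "\<And>x. x \<in> \<Omega> \<Longrightarrow> oim x \<noteq> 0 \<Longrightarrow> dbar_F f x = 0"
    and r: "r > 0"
    and fI: "\<And>z K. z \<in> S \<Longrightarrow> K \<in> imag_sphere \<Longrightarrow> dist K I < r \<Longrightarrow> f (tau K z) = u z + K \<odot> v z"
    and fJ: "\<And>z K. z \<in> S \<Longrightarrow> K \<in> imag_sphere \<Longrightarrow> dist K J < r \<Longrightarrow> f (tau K z) = u z + K \<odot> v z"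
  shows "axial_system S u v"
proof -
  obtain D where D: "\<And>x. x \<in> \<Omega> \<Longrightarrow> (f has_derivative blinfun_apply (D x)) (at x)"
    and contD: "continuous_on \<Omega> D"
    using reg(1) unfolding C1_on_def by blast
  define k where "k = oinv (I - J)"
  have k: "k \<odot> ((I - J) \<odot> y) = y" "(I - J) \<odot> (k \<odot> y) = y" for y
    using oinv_omult[of "I - J" y] IJ(3) by (simp_all add: k_def)
  have df: "((\<lambda>z. f (tau K z)) has_derivative (\<lambda>h. Re h *\<^sub>R D (tau K z) (oe 0) + Im h *\<^sub>R D (tau K z) K)) (at z)"
    if "tau K z \<in> \<Omega>" for K z
    using has_derivative_compose[OF bounded_linear.has_derivative[OF bounded_linear_tau has_derivative_ident] D[OF that]]
    by (simp add: tau_def blinfun.bilinear_simps)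
  have contDK: "continuous_on S (\<lambda>z. blinfun_apply (D (tau K z)) y)" if "\<And>z. z \<in> S \<Longrightarrow> tau K z \<in> \<Omega>" for K y
    by (intro continuous_intros continuous_on_compose2[OF contD]
      linear_continuous_on[OF bounded_linear_tau]) (use that in auto)
  have v_eq: "v z = k \<odot> (f (tau I z) - f (tau J z))" and u_eq: "u z = f (tau I z) - I \<odot> v z" if "z \<in> S" for z
  proof -
    have "f (tau I z) = u z + I \<odot> v z" "f (tau J z) = u z + J \<odot> v z"
      using fI[OF that IJ(1)] fJ[OF that IJ(2)] r by auto
    then show "v z = k \<odot> (f (tau I z) - f (tau J z))" "u z = f (tau I z) - I \<odot> v z"
      using k(1)[of "v z"] by (simp_all add: omult.diff_left)
  qed
  define va where "va z = k \<odot> (D (tau I z) (oe 0) - D (tau J z) (oe 0))" for z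
  define vb where "vb z = k \<odot> (D (tau I z) I - D (tau J z) J)" for z
  define ua where "ua z = D (tau I z) (oe 0) - I \<odot> va z" for z
  define ub where "ub z = D (tau I z) I - I \<odot> vb z" for z
  have cv: "continuous_on S va" "continuous_on S vb"
    unfolding va_def vb_def by (intro continuous_intros omult.continuous_on contDK S; assumption)+
  have cu: "continuous_on S ua" "continuous_on S ub"
    unfolding ua_def ub_def by (intro continuous_intros omult.continuous_on contDK S cv; assumption)+
  have dv: "(v has_derivative (\<lambda>h. Re h *\<^sub>R va z + Im h *\<^sub>R vb z)) (at z)" if z: "z \<in> S" for z
  proof -
    have "((\<lambda>z. k \<odot> (f (tau I z) - f (tau J z))) has_derivative (\<lambda>h. Re h *\<^sub>R va z + Im h *\<^sub>R vb z)) (at z)"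
      using bounded_linear.has_derivative[OF omult.bounded_linear_right[of k]
        has_derivative_diff[OF df[OF S(3)[OF z]] df[OF S(4)[OF z]]]]
      by (simp add: va_def vb_def omult.diff_right omult.add_right omult_scaleR algebra_simps)
    then show ?thesis
      by (rule has_derivative_transform_within_open[OF _ S(1) z]) (simp add: v_eq)
  qed
  have du: "(u has_derivative (\<lambda>h. Re h *\<^sub>R ua z + Im h *\<^sub>R ub z)) (at z)" if z: "z \<in> S" for z
  proof -
    have "((\<lambda>z. f (tau I z) - I \<odot> v z) has_derivative (\<lambda>h. Re h *\<^sub>R ua z + Im h *\<^sub>R ub z)) (at z)"
      using has_derivative_diff[OF df[OF S(3)[OF z]]
        bounded_linear.has_derivative[OF omult.bounded_linear_right[of I] dv[OF z]]]
      by (simp add: ua_def ub_def omult.diff_right omult.add_right omult_scaleR algebra_simps)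
    then show ?thesis
      by (rule has_derivative_transform_within_open[OF _ S(1) z]) (simp add: u_eq)
  qed
  have pde: "ua z - vb z = (2 / Im z) *\<^sub>R v z \<and> va z + ub z = 0" if z: "z \<in> S" for z
  proof -
    have II: "L \<odot> (L \<odot> y) = - y" if "L \<in> imag_sphere" for L y
      using imaginary_omult_omult[of L y] that by (simp add: imag_sphere_def ore_def)
    have oim0: "oim (tau L z) \<noteq> 0" if "L \<in> imag_sphere" for L
      using tau_simps(3)[OF that, of z] S(2)[OF z] by auto
    \<comment> \<open>For L equal to I or J, the rule L (L y) = - y sorts the equation from
      \<open>dbar_F_slice\<close> into a part free of L and a part multiplied by L; these are the
      two equations of the system.\<close>
    have AB: "(ua z - vb z - (2 / Im z) *\<^sub>R v z) + L \<odot> (va z + ub z) = 0"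
      if L: "L \<in> imag_sphere" "tau L z \<in> \<Omega>"
        and f: "\<And>K. K \<in> imag_sphere \<Longrightarrow> dist K L < r \<Longrightarrow> f (tau K z) = u z + K \<odot> v z"
        and A: "D (tau L z) (oe 0) = ua z + L \<odot> va z" and B: "D (tau L z) L = ub z + L \<odot> vb z" for L
    proof -
      have "D (tau L z) (oe 0) + L \<odot> D (tau L z) L - (2 / Im z) *\<^sub>R v z = 0"
        using dbar_F_slice[OF L(1) r S(2)[OF z] f D[OF L(2)]] reg(2)[OF L(2) oim0[OF L(1)]] by simp
      then show ?thesis unfolding A B by (simp add: omult.add_right II[OF L(1)] algebra_simps)
    qed
    have J: "D (tau J z) (oe 0) = ua z + J \<odot> va z" "D (tau J z) J = ub z + J \<odot> vb z"
      using k(2)[of "D (tau I z) (oe 0) - D (tau J z) (oe 0)"] k(2)[of "D (tau I z) I - D (tau J z) J"]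
      by (simp_all add: ua_def ub_def flip: va_def vb_def) (simp_all add: omult.diff_left algebra_simps)
    have "(ua z - vb z - (2 / Im z) *\<^sub>R v z) + I \<odot> (va z + ub z) = 0"
      using S(3)[OF z] fI[OF z] by (intro AB) (auto simp: IJ ua_def ub_def)
    moreover have "(ua z - vb z - (2 / Im z) *\<^sub>R v z) + J \<odot> (va z + ub z) = 0"
      using S(4)[OF z] fJ[OF z] J by (intro AB) (auto simp: IJ)
    ultimately show ?thesis
      using slice_values_unique[OF IJ(3), of "ua z - vb z - (2 / Im z) *\<^sub>R v z" "va z + ub z" 0 0]
      by (simp add: omult.zero_right)
  qed
  have "axial_derivatives S u v ua ub va vb"
    using cu cv du dv pde unfolding axial_derivatives_def by blast
  then show ?thesis unfolding axial_system_def by blast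
qed

text \<open>Openness of \<Omega> provides a product neighbourhood of units and base points. Inside
  it a connected cap of units shares one stem vector over each base point, so the stem vector
  becomes a function of the base alone.\<close>

lemma local_stem_functions:
  assumes "open \<Omega>" "slice_Fueter_regular \<Omega> f"
    and I: "I \<in> imag_sphere" and z0: "Im z0 > 0" "tau I z0 \<in> \<Omega>"
  shows "\<exists>e>0. \<exists>u v. axial_system (ball z0 e) u v \<and>
    (\<forall>z\<in>ball z0 e. Im z > 0 \<and> (\<forall>J\<in>imag_sphere \<inter> ball I e. stem_vector \<Omega> f (tau J z) = (u z, v z)))"
proof -
  have sl: "slice_function \<Omega> f" using assms(2) by (simp add: slice_Fueter_regular_def)
  have "continuous_on UNIV (\<lambda>p. tau (fst p) (snd p))"
    unfolding tau_def by (intro continuous_intros)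
  then have "open ((\<lambda>p. tau (fst p) (snd p)) -` \<Omega>)"
    using \<open>open \<Omega>\<close> by (simp add: open_vimage)
  moreover have "(I, z0) \<in> (\<lambda>p. tau (fst p) (snd p)) -` \<Omega>" using z0 by simp
  ultimately obtain U V where UV: "open U" "open V" "(I, z0) \<in> U \<times> V" "U \<times> V \<subseteq> (\<lambda>p. tau (fst p) (snd p)) -` \<Omega>"
    by (rule open_prod_elim)
  from UV(3) have IU: "I \<in> U" and zV: "z0 \<in> V" by auto
  obtain d where d: "d > 0" "ball I d \<subseteq> U" using openE[OF UV(1) IU] by blast
  have "open (V \<inter> {z. Im z > 0})"
    using UV(2) open_halfspace_Im_gt by (intro open_Int) auto
  then obtain d' where d': "d' > 0" "ball z0 d' \<subseteq> V \<inter> {z. Im z > 0}"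
    using openE[of _ z0] zV z0(1) by blast
  \<comment> \<open>\<open>connected_cap\<close> requires radius at most 1 and may double it, so 2 e
    has to stay below \<open>d\<close>.\<close>
  define e where "e = min 1 (d / 2)"
  have e: "0 < e" "e \<le> 1" "2 * e \<le> d" using d by (auto simp: e_def)
  obtain K where K: "connected K" "imag_sphere \<inter> ball I e \<subseteq> K" "K \<subseteq> imag_sphere \<inter> ball I (2 * e)"
    using connected_cap[OF I e(1,2)] by blast
  define S where "S = ball z0 d'"
  have S: "Im z > 0" "\<And>J. J \<in> K \<Longrightarrow> tau J z \<in> \<Omega>" if "z \<in> S" for z
  proof -
    have z: "z \<in> V" "Im z > 0" using that d'(2) unfolding S_def by auto
    then show "Im z > 0" by simp
    fix J assume "J \<in> K"
    then have "J \<in> U" using K(3) subset_ball[OF e(3), of I] d(2) by blast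
    then show "tau J z \<in> \<Omega>" using UV(4) z by auto
  qed
  have KS: "K \<subseteq> imag_sphere" using K(3) by blast
  have st: "f (tau M z) = fst (stem_vector \<Omega> f (tau L z)) + M \<odot> snd (stem_vector \<Omega> f (tau L z))"
    if "z \<in> S" "L \<in> K" "M \<in> K" for z L M
    using stem_vector_tau[OF assms(1) sl S(1)[OF that(1)] K(1) KS _ that(2,3)] S(2)[OF that(1)] by blast
  \<comment> \<open>Distance e / 2 keeps the ball of radius e / 2 around J, as well as the one
    around I, inside the ball of radius e around I where the slice formula holds.\<close>
  obtain J where J: "J \<in> imag_sphere" "J \<noteq> I" "dist J I < e / 2"
    using exists_near_imag_sphere[OF I, of "e / 2"] e by auto
  have IK: "I \<in> K" using I e K(2) by auto
  have JK: "J \<in> K" using J e K(2) by (auto simp: dist_commute)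
  define u where "u z = fst (stem_vector \<Omega> f (tau I z))" for z
  define v where "v z = snd (stem_vector \<Omega> f (tau I z))" for z
  have uv: "stem_vector \<Omega> f (tau L z) = (u z, v z)" if "z \<in> S" "L \<in> K" for z L
    using slice_values_unique[OF J(2)] st[OF that(1) that(2) IK] st[OF that(1) that(2) JK]
      st[OF that(1) IK IK] st[OF that(1) IK JK]
    unfolding u_def v_def by (metis prod.collapse)
  have f: "f (tau L z) = u z + L \<odot> v z" if "z \<in> S" "L \<in> K" for z L
    using st[OF that(1) that(2) that(2)] uv[OF that] by simp
  have "axial_system S u v"
  proof (rule axial_system_slice[OF I J(1) J(2)[symmetric]])
    show "C1_on \<Omega> f" using assms(2) by (simp add: slice_Fueter_regular_def)
    show "dbar_F f x = 0" if "x \<in> \<Omega>" "oim x \<noteq> 0" for x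
      using assms(2) that by (simp add: slice_Fueter_regular_def)
    show "e / 2 > 0" using e by simp
    show "f (tau L z) = u z + L \<odot> v z" if "z \<in> S" "L \<in> imag_sphere" "dist L I < e / 2" for z L
      using that K(2) e by (intro f) (auto simp: dist_commute)
    show "f (tau L z) = u z + L \<odot> v z" if "z \<in> S" "L \<in> imag_sphere" "dist L J < e / 2" for z L
    proof -
      have "dist L I < e" using dist_triangle[of L I J] that(3) J(3) by linarith
      then show ?thesis using that K(2) by (intro f) (auto simp: dist_commute)
    qed
  qed (use S IK JK in \<open>auto simp: S_def\<close>)
  then have "axial_system (ball z0 (min e d')) u v"
    by (rule axial_system_subset) (auto simp: S_def)
  moreover have "\<forall>z\<in>ball z0 (min e d'). Im z > 0 \<and> (\<forall>J\<in>imag_sphere \<inter> ball I (min e d'). stem_vector \<Omega> f (tau J z) = (u z, v z))"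
    using S(1) uv K(2) by (auto simp: S_def)
  moreover have "min e d' > 0" using e d' by simp
  ultimately show ?thesis by blast
qed

section \<open>Propagation of agreement along coupled liftings\<close>

text \<open>Agreement is required on a neighbourhood of the base point with both units frozen:
  equality at a single base point would not propagate, while equality of germs is what unique
  continuation can use.\<close>

definition stems_agree :: "octonion set \<Rightarrow> (octonion \<Rightarrow> octonion) \<Rightarrow> octonion \<Rightarrow> octonion \<Rightarrow> complex \<Rightarrow> bool" where
  "stems_agree \<Omega> f I J z \<longleftrightarrow> (\<forall>\<^sub>F w in nhds z. stem_vector \<Omega> f (tau I w) = stem_vector \<Omega> f (tau J w))"

lemma stems_agree_cnj: "stems_agree \<Omega> f (- I) (- J) (cnj z) \<longleftrightarrow> stems_agree \<Omega> f I J z"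
proof -
  have *: "stems_agree \<Omega> f (- I) (- J) (cnj z)" if "stems_agree \<Omega> f I J z" for I J z
  proof -
    have "filterlim cnj (nhds z) (nhds (cnj z))"
      using isCont_cnj[OF continuous_ident, of "cnj z"] by (simp add: isCont_def tendsto_nhds_iff)
    from eventually_compose_filterlim[OF that[unfolded stems_agree_def] this]
    show ?thesis unfolding stems_agree_def
      by eventually_elim (metis complex_cnj_cnj tau_uminus_cnj)
  qed
  show ?thesis using *[of I J z] *[of "- I" "- J" "cnj z"] by auto
qed

text \<open>Base points and units vary independently in the conclusion, so that values of a base
  path and of two spherical coordinates at nearby times can be inserted. For Im z > 0 the local stem
  functions are independent of the units and unique continuation applies on a common ball.\<close>

lemma stems_agree_locally_constant:
  assumes "open \<Omega>" "slice_Fueter_regular \<Omega> f"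
    and I: "I1 \<in> imag_sphere" "I2 \<in> imag_sphere" and z: "tau I1 z \<in> \<Omega>" "tau I2 z \<in> \<Omega>"
  shows "\<exists>e>0. \<forall>z'\<in>ball z e. \<forall>z''\<in>ball z e.
    \<forall>J1\<in>imag_sphere \<inter> ball I1 e. \<forall>J2\<in>imag_sphere \<inter> ball I2 e.
    \<forall>K1\<in>imag_sphere \<inter> ball I1 e. \<forall>K2\<in>imag_sphere \<inter> ball I2 e.
      stems_agree \<Omega> f J1 J2 z' \<longrightarrow> stems_agree \<Omega> f K1 K2 z''"
proof -
  have pos: "\<exists>e>0. \<forall>z'\<in>ball z e. \<forall>z''\<in>ball z e.
    \<forall>J1\<in>imag_sphere \<inter> ball I1 e. \<forall>J2\<in>imag_sphere \<inter> ball I2 e.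
    \<forall>K1\<in>imag_sphere \<inter> ball I1 e. \<forall>K2\<in>imag_sphere \<inter> ball I2 e.
      stems_agree \<Omega> f J1 J2 z' \<longrightarrow> stems_agree \<Omega> f K1 K2 z''"
    if I: "I1 \<in> imag_sphere" "I2 \<in> imag_sphere" and z: "tau I1 z \<in> \<Omega>" "tau I2 z \<in> \<Omega>" "Im z > 0" for I1 I2 z
  proof -
    obtain e1 u1 v1 where 1: "e1 > 0" "axial_system (ball z e1) u1 v1"
      "\<And>w. w \<in> ball z e1 \<Longrightarrow> Im w > 0"
      "\<And>w J. w \<in> ball z e1 \<Longrightarrow> J \<in> imag_sphere \<inter> ball I1 e1 \<Longrightarrow> stem_vector \<Omega> f (tau J w) = (u1 w, v1 w)"
      using local_stem_functions[OF assms(1,2) I(1) z(3,1)] by blast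
    obtain e2 u2 v2 where 2: "e2 > 0" "axial_system (ball z e2) u2 v2"
      "\<And>w J. w \<in> ball z e2 \<Longrightarrow> J \<in> imag_sphere \<inter> ball I2 e2 \<Longrightarrow> stem_vector \<Omega> f (tau J w) = (u2 w, v2 w)"
      using local_stem_functions[OF assms(1,2) I(2) z(3,2)] by blast
    define e where "e = min e1 e2"
    have st: "stem_vector \<Omega> f (tau J w) = (u1 w, v1 w)" "stem_vector \<Omega> f (tau J' w) = (u2 w, v2 w)"
      if "w \<in> ball z e" "J \<in> imag_sphere \<inter> ball I1 e" "J' \<in> imag_sphere \<inter> ball I2 e" for w J J'
      using that 1(4)[of w J] 2(3)[of w J'] by (auto simp: e_def)
    have ax: "axial_system (ball z e) u1 v1" "axial_system (ball z e) u2 v2"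
      using 1(2) 2(2) by (auto intro: axial_system_subset simp: e_def)
    have ball: "\<forall>\<^sub>F w in nhds w'. w \<in> ball z e" if "w' \<in> ball z e" for w'
      using that by (intro eventually_nhds_in_open) auto
    have "stems_agree \<Omega> f K1 K2 z''"
      if "z' \<in> ball z e" "z'' \<in> ball z e" "J1 \<in> imag_sphere \<inter> ball I1 e" "J2 \<in> imag_sphere \<inter> ball I2 e"
        "K1 \<in> imag_sphere \<inter> ball I1 e" "K2 \<in> imag_sphere \<inter> ball I2 e" and ag: "stems_agree \<Omega> f J1 J2 z'"
      for z' z'' J1 J2 K1 K2
    proof -
      have "\<forall>\<^sub>F w in nhds z'. u1 w = u2 w \<and> v1 w = v2 w"
        using ag[unfolded stems_agree_def] ball[OF that(1)] by eventually_elim (use st that in auto)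
      then have eq: "u1 w = u2 w \<and> v1 w = v2 w" if "w \<in> ball z e" for w
        using axial_system_unique_continuation[OF convex_ball open_ball _ ax \<open>z' \<in> ball z e\<close> _ that] 1(3)
        by (auto simp: e_def)
      show ?thesis unfolding stems_agree_def
        by (rule eventually_mono[OF ball[OF that(2)]]) (use st eq that in auto)
    qed
    moreover have "e > 0" using 1(1) 2(1) by (simp add: e_def)
    ultimately show ?thesis by blast
  qed
  consider "Im z > 0" | "Im z = 0" | "Im z < 0" by linarith
  then show ?thesis
  proof cases
    case 1
    then show ?thesis by (intro pos I z)
  next
    case 2
    obtain e where e: "e > 0" "ball (tau I1 z) e \<subseteq> \<Omega>" using assms(1) z(1) openE by blast
    \<comment> \<open>At a real base point agreement holds unconditionally: \<open>tau K w\<close>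
      is as far from the real point as w is from z, so every unit over a nearby w is
      admissible.\<close>
    have "stems_agree \<Omega> f K1 K2 z''" if "z'' \<in> ball z e" "K1 \<in> imag_sphere" "K2 \<in> imag_sphere" for z'' K1 K2
    proof -
      have "\<forall>\<^sub>F w in nhds z''. w \<in> ball z e"
        using that(1) by (intro eventually_nhds_in_open) auto
      then show ?thesis unfolding stems_agree_def
      proof eventually_elim
        case (elim w)
        have "tau K w \<in> \<Omega>" if "K \<in> imag_sphere" for K
        proof -
          have "tau I1 z - tau K w = tau K (z - w)" using 2 by (simp add: tau_def algebra_simps)
          then have "dist (tau I1 z) (tau K w) = dist z w"
            using norm_tau[OF that] by (simp add: dist_norm)
          then show ?thesis using elim e(2) by auto
        qed
        then show ?case
          using assms that by (intro stem_vector_independent_near_real) (auto simp: slice_Fueter_regular_def)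
      qed
    qed
    then show ?thesis using e(1) by blast
  next
    case 3
    \<comment> \<open>Replacing each (I, z) by (-I, cnj z) changes no point, so the upper half plane
      case carries over.\<close>
    have "\<exists>e>0. \<forall>z'\<in>ball (cnj z) e. \<forall>z''\<in>ball (cnj z) e.
      \<forall>J1\<in>imag_sphere \<inter> ball (- I1) e. \<forall>J2\<in>imag_sphere \<inter> ball (- I2) e.
      \<forall>K1\<in>imag_sphere \<inter> ball (- I1) e. \<forall>K2\<in>imag_sphere \<inter> ball (- I2) e.
        stems_agree \<Omega> f J1 J2 z' \<longrightarrow> stems_agree \<Omega> f K1 K2 z''"
      using 3 z by (intro pos) (auto simp: tau_uminus_cnj I uminus_imag_sphere)
    then obtain e where e: "e > 0"
      "\<And>z' z'' J1 J2 K1 K2. \<lbrakk>z' \<in> ball (cnj z) e; z'' \<in> ball (cnj z) e;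
        J1 \<in> imag_sphere \<inter> ball (- I1) e; J2 \<in> imag_sphere \<inter> ball (- I2) e;
        K1 \<in> imag_sphere \<inter> ball (- I1) e; K2 \<in> imag_sphere \<inter> ball (- I2) e;
        stems_agree \<Omega> f J1 J2 z'\<rbrakk> \<Longrightarrow> stems_agree \<Omega> f K1 K2 z''" by metis
    have neg: "- J \<in> imag_sphere \<inter> ball (- I) e" if "J \<in> imag_sphere \<inter> ball I e" for I J
      using that uminus_imag_sphere by (auto simp: dist_minus)
    have cj: "cnj w \<in> ball (cnj z) e" if "w \<in> ball z e" for w
      using that by (simp add: dist_norm flip: complex_cnj_diff)
    have "stems_agree \<Omega> f K1 K2 z''"
      if "z' \<in> ball z e" "z'' \<in> ball z e" "J1 \<in> imag_sphere \<inter> ball I1 e" "J2 \<in> imag_sphere \<inter> ball I2 e"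
        "K1 \<in> imag_sphere \<inter> ball I1 e" "K2 \<in> imag_sphere \<inter> ball I2 e" "stems_agree \<Omega> f J1 J2 z'"
      for z' z'' J1 J2 K1 K2
      using e(2)[OF cj[OF that(1)] cj[OF that(2)] neg[OF that(3)] neg[OF that(4)] neg[OF that(5)] neg[OF that(6)]]
        that(7) by (simp add: stems_agree_cnj)
    then show ?thesis using e(1) by blast
  qed
qed

text \<open>Agreement of the two stem germs at time t is locally constant in t, so it spreads from 0
  to 1 by connectedness of the interval; a germ identity at time 1 includes the endpoints
  themselves.\<close>

lemma CCL_connected_stem_vector_eq:
  assumes "open \<Omega>" "slice_Fueter_regular \<Omega> f" "CCL_connected \<Omega> x1 x2"
  shows "stem_vector \<Omega> f x1 = stem_vector \<Omega> f x2"
proof -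
  obtain \<gamma> \<Theta>1 \<Theta>2 where p: "path \<gamma>" "path \<Theta>1" "path \<Theta>2"
    and S: "path_image \<Theta>1 \<subseteq> imag_sphere" "path_image \<Theta>2 \<subseteq> imag_sphere"
    and start: "pathstart \<Theta>1 = pathstart \<Theta>2"
    and \<Omega>: "path_image (circular_lifting \<gamma> \<Theta>1) \<subseteq> \<Omega>" "path_image (circular_lifting \<gamma> \<Theta>2) \<subseteq> \<Omega>"
    and fin: "pathfinish (circular_lifting \<gamma> \<Theta>1) = x1" "pathfinish (circular_lifting \<gamma> \<Theta>2) = x2"
    using assms(3) unfolding CCL_connected_def by (elim conjE exE) (rule that)
  define P where "P t \<longleftrightarrow> stems_agree \<Omega> f (\<Theta>1 t) (\<Theta>2 t) (\<gamma> t)" for t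
  have "P 1"
  proof (rule connected_induction_simple[of "{0..1::real}" 0 1 P])
    \<comment> \<open>The spherical coordinates start at the same unit, so both germs at time 0 are
      literally the same.\<close>
    show "P 0" using start by (simp add: P_def stems_agree_def pathstart_def)
    fix t :: real assume t: "t \<in> {0..1}"
    have T: "\<Theta>1 s \<in> imag_sphere" "\<Theta>2 s \<in> imag_sphere" if "s \<in> {0..1}" for s
      using S that by (auto simp: path_image_def)
    have in\<Omega>: "tau (\<Theta>1 t) (\<gamma> t) \<in> \<Omega>" "tau (\<Theta>2 t) (\<gamma> t) \<in> \<Omega>"
      using \<Omega> t by (auto simp: path_image_def circular_lifting_def)
    obtain e where e: "e > 0"
      "\<And>z' z'' J1 J2 K1 K2. \<lbrakk>z' \<in> ball (\<gamma> t) e; z'' \<in> ball (\<gamma> t) e;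
        J1 \<in> imag_sphere \<inter> ball (\<Theta>1 t) e; J2 \<in> imag_sphere \<inter> ball (\<Theta>2 t) e;
        K1 \<in> imag_sphere \<inter> ball (\<Theta>1 t) e; K2 \<in> imag_sphere \<inter> ball (\<Theta>2 t) e;
        stems_agree \<Omega> f J1 J2 z'\<rbrakk> \<Longrightarrow> stems_agree \<Omega> f K1 K2 z''"
      using stems_agree_locally_constant[OF assms(1,2) T[OF t] in\<Omega>] by metis
    \<comment> \<open>Times at which the base and both spherical coordinates stay within
      \<open>e\<close> of their values at t; this is relatively open because all three are
      paths.\<close>
    define U where "U = ({0..1} \<inter> \<gamma> -` ball (\<gamma> t) e) \<inter> ({0..1} \<inter> \<Theta>1 -` ball (\<Theta>1 t) e) \<inter> ({0..1} \<inter> \<Theta>2 -` ball (\<Theta>2 t) e)"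
    have "openin (top_of_set {0..1}) U"
      unfolding U_def using p unfolding path_def
      by (intro openin_Int continuous_openin_preimage_gen) auto
    moreover have "t \<in> U" using t e(1) by (simp add: U_def)
    moreover have "P s'" if s: "s \<in> U" "s' \<in> U" and "P s" for s s'
      unfolding P_def using s T[of s] T[of s'] \<open>P s\<close>[unfolded P_def]
      by (intro e(2)[of "\<gamma> s" "\<gamma> s'" "\<Theta>1 s" "\<Theta>2 s"]) (auto simp: U_def)
    ultimately show "\<exists>T. openin (top_of_set {0..1}) T \<and> t \<in> T \<and> (\<forall>x\<in>T. \<forall>y\<in>T. P x \<longrightarrow> P y)"
      by blast
  qed auto
  then have "stem_vector \<Omega> f (tau (\<Theta>1 1) (\<gamma> 1)) = stem_vector \<Omega> f (tau (\<Theta>2 1) (\<gamma> 1))"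
    unfolding P_def stems_agree_def by (rule eventually_nhds_x_imp_x)
  then show ?thesis using fin by (simp add: pathfinish_def circular_lifting_def)
qed

theorem theorem4p13:
  fixes \<Omega> :: "octonion set" and f :: "octonion \<Rightarrow> octonion" and x x' :: octonion
  assumes "open \<Omega>" and "connected \<Omega>" and "\<Omega> \<noteq> {}"
    and "slice_Fueter_regular \<Omega> f"
    and "x \<in> \<Omega>" and "x' \<in> \<Omega>"
    and "CCL_equivalent \<Omega> x x'"
  shows "stem_vector \<Omega> f x = stem_vector \<Omega> f x'"
proof -
  have "(CCL_connected \<Omega>)\<^sup>*\<^sup>* x x'" using assms(7) by (simp add: CCL_equivalent_def)
  then show ?thesis
    by induction (use CCL_connected_stem_vector_eq[OF assms(1,4)] in auto)
qed

end
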